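(* Let $\mathcal{X}$ be an Artin spherical group with classical generators $x_1,\dots,x_n$, and let $\Delta$ be its Garside element. Consider $\mathcal{X}$ as a monoid generated by $\{x_1,\dots,x_n,\nabla\}$ where $\nabla=\Delta^{-1}$, and let $g_k$ be the number of elements of $\mathcal{X}$ whose word length with respect to this monoid generating set equals $k$. Then $(g_k)$ has growth rate less than $4$, i.e. $\limsup_k g_k^{1/k}<4$.
   Context: An Artin spherical group is the group given by the presentation $\langle x_1,\dots,x_n\mid x_ix_jx_i\cdots=x_jx_ix_j\cdots$ (both sides of length $r_{ij}$, for $r_{ij}<\infty$)$\rangle$ where the labels $r_{ij}$ come from a finite Coxeter graph whose connected components are of type $A_n$ ($n\ge1$), $B_n$ ($n\ge2$), $D_n$ ($n\ge4$), $E_6,E_7,E_8$, $F_4$, $G_2$, $H_3$, $H_4$, or $I_2(p)$ ($p\ge5,p\ne6$) (the finite Coxeter groups' diagrams; $r_{ij}=2$ if no edge, $3$ for an unlabeled edge). The Garside element $\Delta$ is the least common (left) multiple of $x_1,\dots,x_n$ in the associated positive monoid $\mathcal{X}^+$ (the monoid with the same presentation). A sequence $(s_k)$ of positive numbers has growth rate less than $\gamma$ if $\limsup_k \exp(\log(s_k)/k)<\gamma$. *)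

theory Defs
  imports Complex_Main "HOL-Library.Extended_Real" "HOL-Library.Liminf_Limsup"
begin

text \<open>A Coxeter diagram on vertices 0..k-1 is given by a list of labelled edges (i, j, m);
  non-listed pairs carry label 2.\<close>

definition diag_lab :: "(nat \<times> nat \<times> nat) list \<Rightarrow> nat \<Rightarrow> nat \<Rightarrow> nat" where
  "diag_lab es i j =
     (case find (\<lambda>(a, b, m). {a, b} = {i, j}) es of Some (_, _, m) \<Rightarrow> m | None \<Rightarrow> 2)"

definition chain_edges :: "nat \<Rightarrow> nat \<Rightarrow> (nat \<times> nat \<times> nat) list" where
  "chain_edges a b = map (\<lambda>i. (i, Suc i, 3)) [a..<b]"

definition diag_A :: "nat \<Rightarrow> (nat \<times> nat \<times> nat) list" where
  "diag_A k = chain_edges 0 (k - 1)"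
definition diag_B :: "nat \<Rightarrow> (nat \<times> nat \<times> nat) list" where
  "diag_B k = (0, 1, 4) # chain_edges 1 (k - 1)"
definition diag_D :: "nat \<Rightarrow> (nat \<times> nat \<times> nat) list" where
  "diag_D k = (k - 3, k - 1, 3) # chain_edges 0 (k - 2)"
definition diag_E :: "nat \<Rightarrow> (nat \<times> nat \<times> nat) list" where
  "diag_E k = (2, k - 1, 3) # chain_edges 0 (k - 2)"
definition diag_F4 :: "(nat \<times> nat \<times> nat) list" where
  "diag_F4 = [(0, 1, 3), (1, 2, 4), (2, 3, 3)]"
definition diag_H :: "nat \<Rightarrow> (nat \<times> nat \<times> nat) list" where
  "diag_H k = (0, 1, 5) # chain_edges 1 (k - 1)"
definition diag_I2 :: "nat \<Rightarrow> (nat \<times> nat \<times> nat) list" where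
  "diag_I2 p = [(0, 1, p)]"

text \<open>Connected Coxeter diagrams of finite type with k vertices:
  A_k (k>=1), B_k (k>=2), D_k (k>=4), E_6, E_7, E_8, F_4, G_2 (= I_2(6)), H_3, H_4,
  I_2(p) (p>=5, p~=6).\<close>
definition std_diag :: "nat \<Rightarrow> (nat \<times> nat \<times> nat) list \<Rightarrow> bool" where
  "std_diag k es \<longleftrightarrow>
     (k \<ge> 1 \<and> es = diag_A k) \<or> (k \<ge> 2 \<and> es = diag_B k) \<or> (k \<ge> 4 \<and> es = diag_D k) \<or>
     (k \<in> {6, 7, 8} \<and> es = diag_E k) \<or> (k = 4 \<and> es = diag_F4) \<or>
     (k = 2 \<and> es = diag_I2 6) \<or> (k \<in> {3, 4} \<and> es = diag_H k) \<or>
     (\<exists>p. k = 2 \<and> p \<ge> 5 \<and> p \<noteq> 6 \<and> es = diag_I2 p)"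

text \<open>A Coxeter matrix M on the generators 0..n-1 (off-diagonal entries used) is spherical
  if its vertex set splits into blocks (the connected components), with label 2 between
  different blocks, each block being isomorphic to one of the standard diagrams.\<close>
definition spherical :: "nat \<Rightarrow> (nat \<Rightarrow> nat \<Rightarrow> nat) \<Rightarrow> bool" where
  "spherical n M \<longleftrightarrow>
     (\<exists>P. \<Union>P = {..<n} \<and> (\<forall>C\<in>P. C \<noteq> {}) \<and>
          (\<forall>C\<in>P. \<forall>D\<in>P. C \<noteq> D \<longrightarrow> C \<inter> D = {}) \<and>
          (\<forall>C\<in>P. \<forall>D\<in>P. C \<noteq> D \<longrightarrow> (\<forall>i\<in>C. \<forall>j\<in>D. M i j = 2)) \<and>
          (\<forall>C\<in>P. \<exists>f es. bij_betw f C {..<card C} \<and> std_diag (card C) es \<and>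
                     (\<forall>i\<in>C. \<forall>j\<in>C. i \<noteq> j \<longrightarrow> M i j = diag_lab es (f i) (f j))))"

definition alt :: "nat \<Rightarrow> nat \<Rightarrow> nat \<Rightarrow> nat list" where
  "alt i j m = map (\<lambda>k. if even k then i else j) [0..<m]"

inductive peq :: "nat \<Rightarrow> (nat \<Rightarrow> nat \<Rightarrow> nat) \<Rightarrow> nat list \<Rightarrow> nat list \<Rightarrow> bool"
  for n M where
  prefl: "peq n M u u"
| psym: "peq n M u v \<Longrightarrow> peq n M v u"
| ptrans: "peq n M u v \<Longrightarrow> peq n M v w \<Longrightarrow> peq n M u w"
| prel: "i < n \<Longrightarrow> j < n \<Longrightarrow> i \<noteq> j \<Longrightarrow>
         peq n M (u @ alt i j (M i j) @ v) (u @ alt j i (M i j) @ v)"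

text \<open>Group words: letters (i, True) = x_i, (i, False) = x_i^{-1}. Congruence of the Artin group.\<close>
inductive geq :: "nat \<Rightarrow> (nat \<Rightarrow> nat \<Rightarrow> nat) \<Rightarrow> (nat \<times> bool) list \<Rightarrow> (nat \<times> bool) list \<Rightarrow> bool"
  for n M where
  grefl: "geq n M u u"
| gsym: "geq n M u v \<Longrightarrow> geq n M v u"
| gtrans: "geq n M u v \<Longrightarrow> geq n M v w \<Longrightarrow> geq n M u w"
| gcancel: "i < n \<Longrightarrow> geq n M (u @ [(i, b), (i, \<not> b)] @ v) (u @ v)"
| grel: "i < n \<Longrightarrow> j < n \<Longrightarrow> i \<noteq> j \<Longrightarrow>
         geq n M (u @ map (\<lambda>a. (a, True)) (alt i j (M i j)) @ v)
                 (u @ map (\<lambda>a. (a, True)) (alt j i (M i j)) @ v)"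

definition gclass :: "nat \<Rightarrow> (nat \<Rightarrow> nat \<Rightarrow> nat) \<Rightarrow> (nat \<times> bool) list \<Rightarrow> (nat \<times> bool) list set" where
  "gclass n M w = {v. geq n M w v}"

definition pos_word :: "nat \<Rightarrow> nat list \<Rightarrow> bool" where
  "pos_word n w \<longleftrightarrow> set w \<subseteq> {..<n}"

definition common_left_mult :: "nat \<Rightarrow> (nat \<Rightarrow> nat \<Rightarrow> nat) \<Rightarrow> nat list \<Rightarrow> bool" where
  "common_left_mult n M W \<longleftrightarrow> pos_word n W \<and>
     (\<forall>i<n. \<exists>u. pos_word n u \<and> peq n M (u @ [i]) W)"

definition is_garside :: "nat \<Rightarrow> (nat \<Rightarrow> nat \<Rightarrow> nat) \<Rightarrow> nat list \<Rightarrow> bool" where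
  "is_garside n M D \<longleftrightarrow> common_left_mult n M D \<and>
     (\<forall>W. common_left_mult n M W \<longrightarrow> (\<exists>v. pos_word n v \<and> peq n M (v @ D) W))"

definition garside :: "nat \<Rightarrow> (nat \<Rightarrow> nat \<Rightarrow> nat) \<Rightarrow> nat list" where
  "garside n M = (SOME D. is_garside n M D)"

text \<open>Monoid alphabet: Some i = x_i, None = nabla = Delta^{-1}.\<close>
definition nabla_word :: "nat \<Rightarrow> (nat \<Rightarrow> nat \<Rightarrow> nat) \<Rightarrow> (nat \<times> bool) list" where
  "nabla_word n M = rev (map (\<lambda>a. (a, False)) (garside n M))"

definition eval_word :: "nat \<Rightarrow> (nat \<Rightarrow> nat \<Rightarrow> nat) \<Rightarrow> nat option list \<Rightarrow> (nat \<times> bool) list" where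
  "eval_word n M w =
     concat (map (\<lambda>a. case a of Some i \<Rightarrow> [(i, True)] | None \<Rightarrow> nabla_word n M) w)"

definition valid_mword :: "nat \<Rightarrow> nat option list \<Rightarrow> bool" where
  "valid_mword n w \<longleftrightarrow> (\<forall>a\<in>set w. a = None \<or> (\<exists>i<n. a = Some i))"

definition sphere_count :: "nat \<Rightarrow> (nat \<Rightarrow> nat \<Rightarrow> nat) \<Rightarrow> nat \<Rightarrow> nat" where
  "sphere_count n M k = card {c.
     (\<exists>w. valid_mword n w \<and> length w = k \<and> c = gclass n M (eval_word n M w)) \<and>
     \<not> (\<exists>w. valid_mword n w \<and> length w < k \<and> c = gclass n M (eval_word n M w))}"

end

theory Submission
  imports Defs
begin

text \<open>
  The Garside element satisfies \<open>\<Delta> x\<^sub>j = x\<^sub>j\<^sub>' \<Delta>\<close>, so every word in the generators and \<open>\<nabla>\<close> equals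
  \<open>\<nabla> ^ r * p\<close> with \<open>p\<close> positive, and \<open>g\<^sub>k\<close> is at most the number of elements of length at most \<open>k\<close> of
  the positive monoid. That monoid is a length-preserving quotient of the right-angled monoid having only
  the commutation relations of the diagram, whose elements have normal forms in which no letter is
  followed by a commuting letter of smaller rank. Because the diagram is a disjoint union of caterpillar
  trees of type \<open>A\<close>, \<open>D\<close> or \<open>E\<close> (labels disregarded), the transition matrix of the normal forms has spectral
  radius less than 4; positive weights with \<open>A \<phi> < 4 \<phi>\<close> witness this.

  That \<open>\<Delta>\<close> exists at all requires least common multiples in the positive monoid. They are obtained as by
  Garside and by Brieskorn and Saito, the three-generator case being the computation of word reversings
  in types \<open>A\<^sub>3\<close>, \<open>B\<^sub>3\<close>, \<open>H\<^sub>3\<close>. A common multiple of all generators is built inductively in the classical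
  types, and in the exceptional types it is checked that a suitable power of a Coxeter element is one.
\<close>

section \<open>Least common multiples in Artin monoids\<close>

text \<open>The bound 4 is strict for each diagram but not uniform. On a path with n vertices,
  ranked along the path, a letter i may be followed by every j \<ge> i - 1; this matrix has spectral
  radius 4 cos^2(pi/(n+2)), which tends to 4. The weights must therefore depend on the number of
  vertices, and a fork leaves little room. Several components are no worse than one: ranking one
  component above another makes the matrix block triangular. \<Delta> is picked by a choice
  operator, so nothing can be said about it before a least common multiple is known to exist. That
  argument compares the first letters of congruent words. Its obstacle is the transitivity of the
  congruence, where three first letters meet; this is why three-generator subdiagrams decide. The
  labels of I_2(p) are unbounded, but within a triple such a pair stands beside an isolated vertex,
  which is treated symbolically. The other triples form a finite list and are computed.\<close>

lemma alt_0 [simp]: "alt i j 0 = []"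
  by (simp add: alt_def)

lemma alt_Suc [simp]: "alt i j (Suc m) = i # alt j i m"
proof -
  have "[0..<Suc m] = 0 # map Suc [0..<m]"
    by (simp only: upt_conv_Cons map_Suc_upt)
  then show ?thesis by (auto simp: alt_def)
qed

lemma length_alt [simp]: "length (alt i j m) = m"
  by (simp add: alt_def)

lemma set_alt: "set (alt i j m) \<subseteq> {i, j}"
  by (auto simp: alt_def)

lemma map_alt: "map g (alt i j m) = alt (g i) (g j) m"
  by (simp add: alt_def)

lemma alt_snoc: "alt i j (Suc m) = alt i j m @ [if even m then i else j]"
  by (simp add: alt_def)

lemma rev_alt: "rev (alt i j m) = (if even m then alt j i m else alt i j m)"
proof (induction m arbitrary: i j)
  case (Suc m)
  have "rev (alt i j (Suc m)) = rev (alt j i m) @ [i]" by simp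
  also have "\<dots> = (if even m then alt i j m else alt j i m) @ [i]" by (simp add: Suc)
  also have "\<dots> = (if even (Suc m) then alt j i (Suc m) else alt i j (Suc m))"
    by (simp only: alt_snoc) auto
  finally show ?case .
qed simp

declare peq.prefl [simp, intro] and peq.ptrans [trans]

lemma peq_append:
  assumes "peq n M u v"
  shows "peq n M (x @ u @ y) (x @ v @ y)"
  using assms
proof induction
  case (prel i j u v)
  then show ?case using peq.prel[of i n j M "x @ u" "v @ y"] by simp
qed (blast intro: peq.prefl peq.psym peq.ptrans)+

lemma peq_Cons: "peq n M u v \<Longrightarrow> peq n M (a # u) (a # v)"
  using peq_append[of n M u v "[a]" "[]"] by simp

lemma peq_appL: "peq n M u v \<Longrightarrow> peq n M (x @ u) (x @ v)"
  using peq_append[of n M u v x "[]"] by simp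

lemma peq_appR: "peq n M u v \<Longrightarrow> peq n M (u @ x) (v @ x)"
  using peq_append[of n M u v "[]" x] by simp

lemma peq_length: "peq n M u v \<Longrightarrow> length u = length v"
  by (induction rule: peq.induct) auto

lemma peq_pos_word: "peq n M u v \<Longrightarrow> pos_word n u \<longleftrightarrow> pos_word n v"
proof (induction rule: peq.induct)
  case (prel i j u v)
  then show ?case using set_alt[of i j "M i j"] set_alt[of j i "M i j"]
    by (auto simp: pos_word_def)
qed auto

lemma peq_relabel:
  assumes "peq k L u v" and "inj_on g {..<k}" and "g ` {..<k} \<subseteq> {..<n}"
    and "\<And>i j. i < k \<Longrightarrow> j < k \<Longrightarrow> i \<noteq> j \<Longrightarrow> M (g i) (g j) = L i j"
  shows "peq n M (map g u) (map g v)"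
  using assms(1)
proof induction
  case (prel i j u v)
  have "g i \<noteq> g j" using prel assms(2) by (auto simp: inj_on_def)
  then show ?case
    using peq.prel[of "g i" n "g j" M "map g u" "map g v"] prel assms(3,4) by (auto simp: map_alt)
qed (blast intro: peq.prefl peq.psym peq.ptrans)+

text \<open>\<open>right_compl M a b\<close> is the word that completes \<open>a\<close> to the least common right multiple of
  \<open>a\<close> and \<open>b\<close>.\<close>

definition right_compl :: "(nat \<Rightarrow> nat \<Rightarrow> nat) \<Rightarrow> nat \<Rightarrow> nat \<Rightarrow> nat list" where
  "right_compl M a b = (if a = b then [] else alt b a (M a b - 1))"

text \<open>Word reversing. If \<open>reversing L f p q = Some (s, t)\<close> then \<open>p @ s\<close> and \<open>q @ t\<close> both represent
  the least common right multiple of \<open>p\<close> and \<open>q\<close>; \<open>f\<close> only bounds the recursion depth.\<close>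

fun reversing :: "(nat \<Rightarrow> nat \<Rightarrow> nat) \<Rightarrow> nat \<Rightarrow> nat list \<Rightarrow> nat list \<Rightarrow> (nat list \<times> nat list) option" where
  "reversing L f [] q = Some (q, [])"
| "reversing L f (a # p) [] = Some ([], a # p)"
| "reversing L 0 (a # p) (b # q) = None"
| "reversing L (Suc f) (a # p) (b # q) =
     (case reversing L f p (right_compl L a b) of None \<Rightarrow> None | Some (s, t) \<Rightarrow>
     (case reversing L f q (right_compl L b a @ t) of None \<Rightarrow> None | Some (s', t') \<Rightarrow> Some (s @ t', s')))"

text \<open>A recursive form of \<open>diag_lab\<close>: it evaluates on closed edge lists and
  admits induction over the list.\<close>

fun edge_label :: "(nat \<times> nat \<times> nat) list \<Rightarrow> nat \<Rightarrow> nat \<Rightarrow> nat" where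
  "edge_label [] i j = 2"
| "edge_label ((a, b, m) # es) i j = (if a = i \<and> b = j \<or> a = j \<and> b = i then m else edge_label es i j)"

lemma diag_lab_eq_edge_label: "diag_lab es i j = edge_label es i j"
  by (induction es) (auto simp: diag_lab_def doubleton_eq_iff split: if_splits)

lemma right_compl_map:
  assumes "inj_on g {..<k}" and "\<And>i j. i < k \<Longrightarrow> j < k \<Longrightarrow> i \<noteq> j \<Longrightarrow> M (g i) (g j) = L i j"
    and "a < k" "b < k"
  shows "map g (right_compl L a b) = right_compl M (g a) (g b)"
  using assms by (auto simp: right_compl_def map_alt inj_on_def)

lemma set_right_compl: "set (right_compl L a b) \<subseteq> {a, b}"
  using set_alt[of b a "L a b - 1"] by (auto simp: right_compl_def)

section \<open>Correctness of word reversing and the cube condition\<close>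

locale sym_matrix =
  fixes n :: nat and M :: "nat \<Rightarrow> nat \<Rightarrow> nat"
  assumes sym: "i < n \<Longrightarrow> j < n \<Longrightarrow> i \<noteq> j \<Longrightarrow> M i j = M j i"
    and ge2: "i < n \<Longrightarrow> j < n \<Longrightarrow> i \<noteq> j \<Longrightarrow> M i j \<ge> 2"
begin

abbreviation eqv (infix "\<approx>" 50) where "u \<approx> v \<equiv> peq n M u v"

text \<open>Read backwards, a braid relation is again a braid relation, with its sides swapped if
  the label is even. This symmetry turns results on right multiples into results on the left
  multiples by which \<Delta> is defined.\<close>

lemma peq_rev:
  assumes "u \<approx> v"
  shows "rev u \<approx> rev v"
  using assms
proof induction
  case (prel i j u v)
  have "peq n M (rev v @ alt i j (M i j) @ rev u) (rev v @ alt j i (M i j) @ rev u)"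
    using peq.prel[of i n j M "rev v" "rev u"] prel by auto
  then show ?case by (auto simp: rev_alt intro: peq.psym)
qed (blast intro: peq.prefl peq.psym peq.ptrans)+

lemma right_compl_eqv:
  assumes "a < n" "b < n"
  shows "a # right_compl M a b \<approx> b # right_compl M b a"
proof (cases "a = b")
  case False
  obtain m where m: "M a b = Suc m" using ge2[OF assms False] by (cases "M a b") auto
  then show ?thesis
    using peq.prel[of a n b M "[]" "[]"] assms False sym[OF assms False] by (simp add: right_compl_def)
qed simp

text \<open>The relabelling \<open>g\<close> transports computations done with concrete letters to the letters of \<open>M\<close>.\<close>

lemma reversing_sound:
  assumes g: "inj_on g {..<k}" "g ` {..<k} \<subseteq> {..<n}"
    "\<And>i j. i < k \<Longrightarrow> j < k \<Longrightarrow> i \<noteq> j \<Longrightarrow> M (g i) (g j) = L i j"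
    and "reversing L f p q = Some (s, t)" and "set p \<union> set q \<subseteq> {..<k}"
  shows "set s \<union> set t \<subseteq> {..<k} \<and> map g (p @ s) \<approx> map g (q @ t)"
  using assms(4,5)
proof (induction f arbitrary: p q s t)
  case 0
  then show ?case by (cases p; cases q) auto
next
  case (Suc f)
  show ?case
  proof (cases "p = [] \<or> q = []")
    case True
    then show ?thesis using Suc.prems by (cases p; cases q) auto
  next
    case False
    then obtain a p' b q' where pq: "p = a # p'" "q = b # q'" by (meson neq_Nil_conv)
    from Suc.prems(1) obtain s1 t1 s2 t2 where
      r1: "reversing L f p' (right_compl L a b) = Some (s1, t1)" and r2: "reversing L f q' (right_compl L b a @ t1) = Some (s2, t2)"
      and st: "s = s1 @ t2" "t = s2"
      by (auto simp: pq split: option.splits)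
    have ab: "a < k" "b < k" "set p' \<subseteq> {..<k}" "set q' \<subseteq> {..<k}" using Suc.prems pq by auto
    have sc: "set (right_compl L a b) \<subseteq> {..<k}" "set (right_compl L b a) \<subseteq> {..<k}"
      using set_right_compl[of L a b] set_right_compl[of L b a] ab by auto
    have i1: "set s1 \<union> set t1 \<subseteq> {..<k} \<and> map g (p' @ s1) \<approx> map g (right_compl L a b @ t1)"
      using Suc.IH[OF r1] ab sc by auto
    have i2: "set s2 \<union> set t2 \<subseteq> {..<k} \<and> map g (q' @ s2) \<approx> map g ((right_compl L b a @ t1) @ t2)"
      using Suc.IH[OF r2] ab sc i1 by auto
    have c: "map g (right_compl L a b) = right_compl M (g a) (g b)" "map g (right_compl L b a) = right_compl M (g b) (g a)"
      using right_compl_map[of g k M L, OF g(1,3)] ab by auto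
    have "map g (p @ s) = g a # map g (p' @ s1) @ map g t2" by (simp add: pq st)
    also have "\<dots> \<approx> (g a # right_compl M (g a) (g b)) @ map g t1 @ map g t2"
      using i1 by (auto simp: c intro!: peq_Cons dest: peq_appR[of _ _ _ _ "map g t2"])
    also have "\<dots> \<approx> (g b # right_compl M (g b) (g a)) @ map g t1 @ map g t2"
      by (rule peq_appR, rule right_compl_eqv) (use ab g(2) in auto)
    also have "\<dots> \<approx> g b # map g q' @ map g s2"
      using i2 by (auto simp: c intro!: peq_Cons intro: peq.psym)
    finally show ?thesis using i1 i2 by (auto simp: st pq)
  qed
qed

text \<open>Says that \<open>a # X\<close> and \<open>b # Y\<close> pass through the least common
  multiple of \<open>a\<close> and \<open>b\<close>. Words are not confined to letters below
  \<open>n\<close>, hence the bound is demanded for different letters only.\<close>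

definition head_lcm :: "nat \<Rightarrow> nat \<Rightarrow> nat list \<Rightarrow> nat list \<Rightarrow> bool" where
  "head_lcm a b X Y \<longleftrightarrow> (a \<noteq> b \<longrightarrow> a < n \<and> b < n) \<and>
     (\<exists>U. X \<approx> right_compl M a b @ U \<and> Y \<approx> right_compl M b a @ U)"

text \<open>Combines division by two letters with left cancellation, which is the case of equal
  letters, for words of length at most \<open>N\<close>; the bound makes it an induction
  hypothesis.\<close>

definition lcm_below :: "nat \<Rightarrow> bool" where
  "lcm_below N \<longleftrightarrow>
     (\<forall>a b X Y. length X < N \<longrightarrow> a # X \<approx> b # Y \<longrightarrow> head_lcm a b X Y)"

lemma lcm_belowD:
  "lcm_below N \<Longrightarrow> a # X \<approx> b # Y \<Longrightarrow> length X < N \<Longrightarrow> head_lcm a b X Y"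
  by (auto simp: lcm_below_def)

lemma head_lcm_same [simp]: "head_lcm a a X Y \<longleftrightarrow> X \<approx> Y"
  by (auto simp: head_lcm_def right_compl_def intro: peq.prefl) (metis peq.psym peq.ptrans)

lemma cancel_below:
  assumes "lcm_below N" "p @ U \<approx> p @ V" "length (p @ U) \<le> N"
  shows "U \<approx> V"
  using assms(2,3)
proof (induction p)
  case (Cons a p)
  then show ?case using lcm_belowD[OF assms(1), of a "p @ U" a "p @ V"] by auto
qed simp

text \<open>Reversing fills a diagram by tiles, one per pair of letters. Applying
  \<open>lcm_below\<close> at each tile pushes the given common multiple past it, so
  \<open>s\<close> and \<open>t\<close> divide the cofactors of every common multiple within the
  bound.\<close>

lemma reversing_complete:
  assumes g: "inj_on g {..<k}" "g ` {..<k} \<subseteq> {..<n}"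
    "\<And>i j. i < k \<Longrightarrow> j < k \<Longrightarrow> i \<noteq> j \<Longrightarrow> M (g i) (g j) = L i j"
    and N: "lcm_below N"
    and "reversing L f p q = Some (s, t)" and "set p \<union> set q \<subseteq> {..<k}"
    and "map g p @ U \<approx> map g q @ V" and "length (map g p @ U) \<le> N"
  shows "\<exists>T. U \<approx> map g s @ T \<and> V \<approx> map g t @ T"
  using assms(5-)
proof (induction f arbitrary: p q s t U V)
  case 0
  then show ?case by (cases p; cases q) (auto intro: peq.psym peq.prefl)
next
  case (Suc f)
  show ?case
  proof (cases "p = [] \<or> q = []")
    case True
    then show ?thesis using Suc.prems by (cases p; cases q) (auto intro: peq.psym peq.prefl)
  next
    case False
    then obtain a p' b q' where pq: "p = a # p'" "q = b # q'" by (meson neq_Nil_conv)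
    from Suc.prems(1) obtain s1 t1 s2 t2 where
      r1: "reversing L f p' (right_compl L a b) = Some (s1, t1)" and r2: "reversing L f q' (right_compl L b a @ t1) = Some (s2, t2)"
      and st: "s = s1 @ t2" "t = s2"
      by (auto simp: pq split: option.splits)
    have ab: "a < k" "b < k" "set p' \<subseteq> {..<k}" "set q' \<subseteq> {..<k}" using Suc.prems pq by auto
    have sc: "set (right_compl L a b) \<subseteq> {..<k}" "set (right_compl L b a) \<subseteq> {..<k}"
      using set_right_compl[of L a b] set_right_compl[of L b a] ab by auto
    have t1: "set t1 \<subseteq> {..<k}"
      using reversing_sound[OF g r1] ab sc by auto
    have c: "map g (right_compl L a b) = right_compl M (g a) (g b)" "map g (right_compl L b a) = right_compl M (g b) (g a)"
      using right_compl_map[of g k M L, OF g(1,3)] ab by auto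
    have len: "length (map g p @ U) = length (map g q @ V)"
      using Suc.prems(3) by (rule peq_length)
    have "head_lcm (g a) (g b) (map g p' @ U) (map g q' @ V)"
      using lcm_belowD[OF N, of "g a" "map g p' @ U" "g b" "map g q' @ V"] Suc.prems by (auto simp: pq)
    then obtain T1 where T1: "map g p' @ U \<approx> map g (right_compl L a b) @ T1"
      "map g q' @ V \<approx> map g (right_compl L b a) @ T1" by (auto simp: head_lcm_def c)
    from Suc.IH[OF r1 _ T1(1)] ab sc Suc.prems obtain T2
      where T2: "U \<approx> map g s1 @ T2" "T1 \<approx> map g t1 @ T2" by (auto simp: pq)
    have "map g q' @ V \<approx> map g (right_compl L b a @ t1) @ T2"
      using T1(2) peq_appL[OF T2(2), of "map g (right_compl L b a)"] by (auto intro: peq.ptrans)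
    from Suc.IH[OF r2 _ this] ab sc t1 Suc.prems len obtain T3
      where T3: "V \<approx> map g s2 @ T3" "T2 \<approx> map g t2 @ T3" by (auto simp: pq)
    have "U \<approx> map g s @ T3"
      using T2(1) peq_appL[OF T3(2), of "map g s1"] by (auto simp: st intro: peq.ptrans)
    then show ?thesis using T3 by (auto simp: st)
  qed
qed

text \<open>The cube condition: what is needed to compose a division of \<open>a\<close> by \<open>c\<close> with a division of \<open>c\<close>
  by \<open>b\<close>.\<close>

definition cube :: "nat \<Rightarrow> nat \<Rightarrow> nat \<Rightarrow> bool" where
  "cube a b c \<longleftrightarrow> (\<forall>N Z U V. lcm_below N \<longrightarrow> length Z \<le> N \<longrightarrow>
     Z \<approx> right_compl M c a @ U \<longrightarrow> Z \<approx> right_compl M c b @ V \<longrightarrow>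
     (\<exists>W. right_compl M a c @ U \<approx> right_compl M a b @ W \<and> right_compl M b c @ V \<approx> right_compl M b a @ W))"

lemma cube_sym: "cube a b c \<Longrightarrow> cube b a c"
  unfolding cube_def by meson

text \<open>An equality with \<open>c\<close> empties a complement and leaves only the hypotheses to
  be combined; for \<open>a = b\<close> the claim is cancellation of
  \<open>right_compl M c a\<close>, within the bound.\<close>

lemma cube_degenerate:
  assumes "a = b \<or> a = c \<or> b = c"
  shows "cube a b c"
proof -
  have 1: "cube a b a" for a b
    unfolding cube_def
  proof (intro allI impI)
    fix N Z U V
    assume "lcm_below N" "length Z \<le> N" "Z \<approx> right_compl M a a @ U" "Z \<approx> right_compl M a b @ V"
    then have "right_compl M a a @ U \<approx> right_compl M a b @ V" "right_compl M b a @ V \<approx> right_compl M b a @ V"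
      by (auto simp: right_compl_def) (metis peq.psym peq.ptrans)+
    then show "\<exists>W. right_compl M a a @ U \<approx> right_compl M a b @ W \<and> right_compl M b a @ V \<approx> right_compl M b a @ W" by blast
  qed
  have 2: "cube a a c" for a c
    unfolding cube_def
  proof (intro allI impI)
    fix N Z U V
    assume *: "lcm_below N" "length Z \<le> N" "Z \<approx> right_compl M c a @ U" "Z \<approx> right_compl M c a @ V"
    have "U \<approx> V"
      using cancel_below[OF *(1), of "right_compl M c a" U V] peq_length[OF *(3)] *(2)
        peq.ptrans[OF peq.psym[OF *(3)] *(4)] by simp
    then show "\<exists>W. right_compl M a c @ U \<approx> right_compl M a a @ W \<and> right_compl M a c @ V \<approx> right_compl M a a @ W"
      by (auto simp: right_compl_def[of _ a a] intro: peq_appL peq.psym)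
  qed
  show ?thesis using assms 1 2 cube_sym by blast
qed

text \<open>The lcm property survives transitivity of the congruence: the cube condition bridges the
  middle word \<open>c # Z\<close>.\<close>

lemma head_lcm_trans:
  assumes "head_lcm a c X Z" "head_lcm c b Z Y" "lcm_below N" "length Z \<le> N" "cube a b c"
  shows "head_lcm a b X Y"
proof -
  obtain U where U: "X \<approx> right_compl M a c @ U" "Z \<approx> right_compl M c a @ U" using assms(1) by (auto simp: head_lcm_def)
  obtain V where V: "Z \<approx> right_compl M c b @ V" "Y \<approx> right_compl M b c @ V" using assms(2) by (auto simp: head_lcm_def)
  obtain W where "right_compl M a c @ U \<approx> right_compl M a b @ W" "right_compl M b c @ V \<approx> right_compl M b a @ W"
    using assms(3-5) U V unfolding cube_def by blast
  then show ?thesis using U V assms(1,2) unfolding head_lcm_def by (metis peq.ptrans)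
qed

end

text \<open>\<open>s\<close> and \<open>t\<close> describe the least common multiple of the three
  letters as seen from \<open>c\<close>. An empty first component of the next two results means that
  \<open>right_compl M a b\<close> and \<open>right_compl M b a\<close> divide the words seen from
  \<open>a\<close> and from \<open>b\<close>; two empty words in the last test mean that the
  quotients \<open>r\<close> and \<open>r'\<close> agree.\<close>

fun cube_check :: "(nat \<Rightarrow> nat \<Rightarrow> nat) \<Rightarrow> nat \<Rightarrow> nat \<Rightarrow> nat \<Rightarrow> nat \<Rightarrow> bool" where
  "cube_check L f a b c =
    (case reversing L f (right_compl L c a) (right_compl L c b) of None \<Rightarrow> False | Some (s, t) \<Rightarrow>
    (case reversing L f (right_compl L a c @ s) (right_compl L a b) of None \<Rightarrow> False | Some (x, r) \<Rightarrow>
    (case reversing L f (right_compl L b c @ t) (right_compl L b a) of None \<Rightarrow> False | Some (x', r') \<Rightarrow>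
      x = [] \<and> x' = [] \<and> reversing L f r r' = Some ([], []))))"

text \<open>The labels of the edges 01, 02, 12 for the types \<open>A\<^sub>3\<close>, \<open>B\<^sub>3\<close>, \<open>H\<^sub>3\<close> under all numberings of the
  vertices.\<close>

definition rank3_labels :: "(nat \<times> nat \<times> nat) list" where
  "rank3_labels = concat (map (\<lambda>q. [(2, 3, q), (3, 2, q), (2, q, 3), (3, q, 2), (q, 2, 3), (q, 3, 2)]) [3, 4, 5])"

text \<open>Each recursive call of \<open>reversing\<close> works under a least common multiple one
  letter shorter, so the depth is at most the length of that multiple. The longest one here is
  \<Delta> of type H_3, of length 15, hence 20 suffices.\<close>

lemma rank3_cube_check:
  "list_all (\<lambda>(x, y, z). cube_check (edge_label [(0, 1, x), (0, 2, y), (1, 2, z)]) 20 0 1 2) rank3_labels"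
  by code_simp

lemma cube_checkE:
  assumes "cube_check L f a b c"
  obtains s t r r' where "reversing L f (right_compl L c a) (right_compl L c b) = Some (s, t)"
    "reversing L f (right_compl L a c @ s) (right_compl L a b) = Some ([], r)"
    "reversing L f (right_compl L b c @ t) (right_compl L b a) = Some ([], r')" "reversing L f r r' = Some ([], [])"
proof -
  obtain s t where 1: "reversing L f (right_compl L c a) (right_compl L c b) = Some (s, t)"
    using assms by (cases "reversing L f (right_compl L c a) (right_compl L c b)") auto
  obtain x r where 2: "reversing L f (right_compl L a c @ s) (right_compl L a b) = Some (x, r)"
    using assms 1 by (cases "reversing L f (right_compl L a c @ s) (right_compl L a b)") auto
  obtain x' r' where 3: "reversing L f (right_compl L b c @ t) (right_compl L b a) = Some (x', r')"
    using assms 1 2 by (cases "reversing L f (right_compl L b c @ t) (right_compl L b a)") auto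
  show ?thesis using that 1 2 3 assms by simp
qed

context sym_matrix
begin

lemma commute_word:
  assumes "c < n" and "\<And>x. x \<in> set p \<Longrightarrow> x < n \<and> x \<noteq> c \<and> M c x = 2"
  shows "c # p \<approx> p @ [c]"
  using assms(2)
proof (induction p)
  case (Cons x p)
  have "[c, x] \<approx> [x, c]"
    using peq.prel[of c n x M "[]" "[]"] assms(1) Cons.prems[of x] by (auto simp: numeral_2_eq_2)
  then have "c # x # p \<approx> x # c # p" using peq_appR[of n M "[c, x]" "[x, c]" p] by simp
  also have "\<dots> \<approx> x # p @ [c]" using Cons by (auto intro: peq_Cons)
  finally show ?case by simp
qed simp

text \<open>Completeness of reversing for a single commuting letter, done by hand because
  \<open>p\<close> will be a complement of unbounded length.\<close>

lemma commuting_division: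
  assumes "lcm_below N" and "\<And>x. x \<in> set p \<Longrightarrow> x \<noteq> b \<and> M x b = 2 \<and> M b x = 2"
    and "p @ U \<approx> b # V" "length (p @ U) \<le> N"
  shows "\<exists>T. U \<approx> b # T \<and> V \<approx> p @ T"
  using assms(2-)
proof (induction p arbitrary: V)
  case Nil
  then show ?case by auto
next
  case (Cons a p)
  have "head_lcm a b (p @ U) V"
    using lcm_belowD[OF assms(1), of a "p @ U" b V] Cons.prems by auto
  then obtain T1 where T1: "p @ U \<approx> b # T1" "V \<approx> a # T1"
    using Cons.prems(1)[of a] by (auto simp: head_lcm_def right_compl_def)
  obtain T where T: "U \<approx> b # T" "T1 \<approx> p @ T"
    using Cons.IH[OF _ T1(1)] Cons.prems by auto
  have "V \<approx> a # p @ T" using T1(2) peq_Cons[OF T(2), of a] by (rule peq.ptrans)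
  then show ?case using T by auto
qed

text \<open>\<open>c\<close> is isolated in the triple, and the label of \<open>a\<close> and
  \<open>b\<close> is arbitrary, so no computation with fixed words covers this case. The witness is
  \<open>c # T\<close>, obtained by moving \<open>c\<close> through the complements of
  \<open>a\<close> and \<open>b\<close>.\<close>

lemma cube_commuting_apex:
  assumes "a < n" "b < n" "c < n" "a \<noteq> c" "b \<noteq> c" "M c a = 2" "M c b = 2"
  shows "cube a b c"
  unfolding cube_def
proof (intro allI impI)
  fix N Z U V
  assume *: "lcm_below N" "length Z \<le> N" "Z \<approx> right_compl M c a @ U" "Z \<approx> right_compl M c b @ V"
  have s: "M a c = 2" "M b c = 2" using sym assms by auto
  then have c: "right_compl M c a = [a]" "right_compl M a c = [c]" "right_compl M c b = [b]" "right_compl M b c = [c]"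
    using assms by (auto simp: right_compl_def)
  have "a # U \<approx> b # V" using * c by (metis append_Cons append_Nil peq.psym peq.ptrans)
  moreover have "length U < N" using peq_length[OF *(3)] *(2) c by auto
  ultimately obtain T where T: "U \<approx> right_compl M a b @ T" "V \<approx> right_compl M b a @ T"
    using lcm_belowD[OF *(1)] unfolding head_lcm_def by blast
  have k: "c # right_compl M x y \<approx> right_compl M x y @ [c]" if "x \<in> {a, b}" "y \<in> {a, b}" for x y
    using commute_word[of c "right_compl M x y"] set_right_compl[of M x y] that assms by auto
  have "c # U \<approx> right_compl M a b @ c # T"
    using peq.ptrans[OF peq_Cons[OF T(1)] peq_appR[OF k[of a b], of T, simplified]] by simp
  moreover have "c # V \<approx> right_compl M b a @ c # T"
    using peq.ptrans[OF peq_Cons[OF T(2)] peq_appR[OF k[of b a], of T, simplified]] by simp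
  ultimately show "\<exists>W. right_compl M a c @ U \<approx> right_compl M a b @ W \<and> right_compl M b c @ V \<approx> right_compl M b a @ W"
    using c by auto
qed

text \<open>Here the isolated letter is \<open>b\<close>. It commutes with
  \<open>right_compl M c a\<close>, hence divides \<open>U\<close>; the witness is
  \<open>right_compl M a c @ T\<close>.\<close>

lemma cube_commuting_side:
  assumes "a < n" "b < n" "c < n" "a \<noteq> b" "a \<noteq> c" "b \<noteq> c" "M a b = 2" "M c b = 2"
  shows "cube a b c"
  unfolding cube_def
proof (intro allI impI)
  fix N Z U V
  assume *: "lcm_below N" "length Z \<le> N" "Z \<approx> right_compl M c a @ U" "Z \<approx> right_compl M c b @ V"
  have s: "M b a = 2" "M b c = 2" using sym[of a b] sym[of c b] assms by auto
  then have c: "right_compl M a b = [b]" "right_compl M b a = [a]" "right_compl M c b = [b]" "right_compl M b c = [c]"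
    using assms by (auto simp: right_compl_def)
  have "right_compl M c a @ U \<approx> b # V" using * c by (metis append_Cons append_Nil peq.psym peq.ptrans)
  moreover have "length (right_compl M c a @ U) \<le> N" using peq_length[OF *(3)] *(2) c by auto
  ultimately obtain T where T: "U \<approx> b # T" "V \<approx> right_compl M c a @ T"
    using commuting_division[OF *(1), of "right_compl M c a" b U V] set_right_compl[of M c a] assms s by auto
  have "b # right_compl M a c \<approx> right_compl M a c @ [b]"
    using commute_word[of b "right_compl M a c"] set_right_compl[of M a c] assms s by auto
  then have "right_compl M a c @ b # T \<approx> b # right_compl M a c @ T"
    using peq.psym[OF peq_appR[of _ _ "b # right_compl M a c" "right_compl M a c @ [b]" T]] by simp
  then have "right_compl M a c @ U \<approx> b # right_compl M a c @ T"
    by (rule peq.ptrans[OF peq_appL[OF T(1), of "right_compl M a c"]])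
  moreover have "c # V \<approx> a # right_compl M a c @ T"
    using peq.ptrans[OF peq_Cons[OF T(2), of c] peq_appR[OF right_compl_eqv[of c a], of T, simplified]] assms
    by simp
  ultimately show "\<exists>W. right_compl M a c @ U \<approx> right_compl M a b @ W \<and> right_compl M b c @ V \<approx> right_compl M b a @ W"
    using c by auto
qed

text \<open>Completeness of reversing splits \<open>U\<close> and \<open>V\<close> over the computed
  \<open>s\<close> and \<open>t\<close>. Soundness carries \<open>r\<close> and \<open>r'\<close>
  over to the letters of \<open>M\<close>, and as they are congruent there, one witness serves both
  sides.\<close>

lemma cube_rank3:
  assumes "a < n" "b < n" "c < n" "a \<noteq> b" "a \<noteq> c" "b \<noteq> c"
    and "(M a b, M a c, M b c) \<in> set rank3_labels"
  shows "cube a b c"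
proof -
  define L where "L = edge_label [(0, 1, M a b), (0, 2, M a c), (1, 2, M b c)]"
  define g :: "nat \<Rightarrow> nat" where "g = (\<lambda>i. if i = 0 then a else if i = 1 then b else c)"
  have g1: "inj_on g {..<3}" using assms by (auto simp: g_def inj_on_def)
  have g2: "g ` {..<3} \<subseteq> {..<n}" using assms by (auto simp: g_def)
  have lt3: "i < 3 \<longleftrightarrow> i = 0 \<or> i = 1 \<or> i = 2" for i :: nat by auto
  have g3: "M (g i) (g j) = L i j" if "i < 3" "j < 3" "i \<noteq> j" for i j
    using that assms sym[of a b] sym[of a c] sym[of b c] unfolding lt3 by (auto simp: g_def L_def)
  note g = g1 g2 g3
  have gs: "g 0 = a" "g (Suc 0) = b" "g 2 = c" by (auto simp: g_def)
  have "cube_check L 20 0 1 2"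
    using rank3_cube_check assms(7) unfolding list_all_iff L_def by blast
  then obtain s t r r' where
      1: "reversing L 20 (right_compl L 2 0) (right_compl L 2 1) = Some (s, t)"
    and 2: "reversing L 20 (right_compl L 0 2 @ s) (right_compl L 0 1) = Some ([], r)"
    and 3: "reversing L 20 (right_compl L 1 2 @ t) (right_compl L 1 0) = Some ([], r')"
    and 4: "reversing L 20 r r' = Some ([], [])"
    by (rule cube_checkE)
  have sc: "set (right_compl L i j) \<subseteq> {..<3}" if "i < 3" "j < 3" for i j
    using set_right_compl[of L i j] that by auto
  have mc: "map g (right_compl L i j) = right_compl M (g i) (g j)" if "i < 3" "j < 3" for i j
    using right_compl_map[of g 3 M L, OF g1 g3] that by auto
  have st: "set s \<union> set t \<subseteq> {..<3}" using reversing_sound[OF g 1] sc by auto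
  have 5: "set r \<subseteq> {..<3}" "right_compl M a c @ map g s \<approx> right_compl M a b @ map g r"
    using reversing_sound[OF g 2] sc st by (auto simp: mc gs)
  have 6: "set r' \<subseteq> {..<3}" "right_compl M b c @ map g t \<approx> right_compl M b a @ map g r'"
    using reversing_sound[OF g 3] sc st by (auto simp: mc gs)
  have 7: "map g r \<approx> map g r'" using reversing_sound[OF g 4] 5 6 by auto
  show ?thesis
    unfolding cube_def
  proof (intro allI impI)
    fix N Z U V
    assume *: "lcm_below N" "length Z \<le> N" "Z \<approx> right_compl M c a @ U" "Z \<approx> right_compl M c b @ V"
    have "map g (right_compl L 2 0) @ U \<approx> map g (right_compl L 2 1) @ V"
      using *(3,4) by (simp add: mc gs) (metis peq.psym peq.ptrans)
    moreover have "length (map g (right_compl L 2 0) @ U) \<le> N"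
      unfolding mc[of 2 0, simplified] gs using peq_length[OF *(3)] *(2) by simp
    ultimately obtain T where T: "U \<approx> map g s @ T" "V \<approx> map g t @ T"
      using reversing_complete[OF g *(1) 1] sc[of 2 0] sc[of 2 1] by fastforce
    have "right_compl M a c @ U \<approx> right_compl M a b @ map g r @ T"
      using peq.ptrans[OF peq_appL[OF T(1), of "right_compl M a c"] peq_appR[OF 5(2), of T, simplified]] .
    moreover have "right_compl M b c @ V \<approx> right_compl M b a @ map g r' @ T"
      using peq.ptrans[OF peq_appL[OF T(2), of "right_compl M b c"] peq_appR[OF 6(2), of T, simplified]] .
    moreover have "right_compl M b a @ map g r' @ T \<approx> right_compl M b a @ map g r @ T"
      by (intro peq_appL peq_appR peq.psym[OF 7])
    ultimately show "\<exists>W. right_compl M a c @ U \<approx> right_compl M a b @ W \<and> right_compl M b c @ V \<approx> right_compl M b a @ W"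
      by (metis peq.ptrans)
  qed
qed

end

text \<open>Every three generators span a subdiagram of finite type: a vertex isolated from a pair
  with any label, or a path of type A_3, B_3 or H_3. On this local condition alone, words with a
  common right multiple have a least one.\<close>

locale spherical_triples = sym_matrix +
  assumes triples: "a < n \<Longrightarrow> b < n \<Longrightarrow> c < n \<Longrightarrow> distinct [a, b, c] \<Longrightarrow>
      M a b = 2 \<and> M a c = 2 \<or> M a b = 2 \<and> M b c = 2 \<or> M a c = 2 \<and> M b c = 2 \<or>
      (M a b, M a c, M b c) \<in> set rank3_labels"
begin

lemma cube_all:
  assumes "a < n" "b < n" "c < n" 
  shows "cube a b c"
proof (cases "distinct [a, b, c]")
  case True
  then have d: "a \<noteq> b" "a \<noteq> c" "b \<noteq> c" by auto
  have s: "M c a = M a c" "M c b = M b c" "M b a = M a b" using sym assms d by auto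
  from triples[OF assms True] consider "M a b = 2" "M a c = 2" | "M a b = 2" "M b c = 2"
    | "M a c = 2" "M b c = 2" | "(M a b, M a c, M b c) \<in> set rank3_labels" by blast
  then show ?thesis
  proof cases
    case 1
    then show ?thesis using cube_commuting_side[of b a c, THEN cube_sym] assms d s by metis
  next
    case 2
    then show ?thesis using cube_commuting_side assms d s by metis
  next
    case 3
    then show ?thesis using cube_commuting_apex assms d s by metis
  next
    case 4
    then show ?thesis using cube_rank3 assms d by metis
  qed
qed (auto intro: cube_degenerate)

text \<open>Induction over the derivation of a congruence between words of length at most
  \<open>Suc N\<close>. A single relation acts at the head or inside the tail; only transitivity
  compares three first letters, and there the cube condition applies with the hypothesis for
  \<open>N\<close>.\<close>

lemma lcm_below_all: "lcm_below N"
proof (induction N)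
  case 0
  show ?case by (simp add: lcm_below_def)
next
  case (Suc N)
  have "head_lcm (hd u) (hd v) (tl u) (tl v)" if "u \<approx> v" "u \<noteq> []" "length u \<le> Suc N" for u v
    using that
  proof induction
    case (psym u v)
    then have "u \<noteq> []" "length u \<le> Suc N" using peq_length[of n M u v] by auto
    then have "head_lcm (hd u) (hd v) (tl u) (tl v)" by (rule psym.IH)
    then show ?case by (auto simp: head_lcm_def)
  next
    case (ptrans u v w)
    have l: "length u = length v" using ptrans.hyps(1) by (rule peq_length)
    have 1: "head_lcm (hd u) (hd v) (tl u) (tl v)" "head_lcm (hd v) (hd w) (tl v) (tl w)"
      using ptrans.IH ptrans.prems l by (metis length_0_conv)+
    \<comment> \<open>By the first clause of \<open>head_lcm\<close>, different neighbours are
      generators: either two of the letters coincide or all three are below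
      \<open>n\<close>.\<close>
    have "cube (hd u) (hd w) (hd v)"
      using 1 cube_degenerate[of "hd u" "hd w" "hd v"] cube_all[of "hd u" "hd w" "hd v"]
      by (auto simp: head_lcm_def)
    then show ?case using head_lcm_trans[OF 1 Suc.IH] ptrans.prems l by auto
  next
    case (prel i j u v)
    show ?case
    proof (cases u)
      case Nil
      obtain m where m: "M i j = Suc m" using ge2[of i j] prel by (cases "M i j") auto
      show ?thesis using prel m sym[of i j] Nil by (auto simp: head_lcm_def right_compl_def)
    next
      case (Cons x u')
      then show ?thesis using prel peq.prel[of i n j M u' v] by simp
    qed
  qed simp
  from this[of "_ # _" "_ # _"] show ?case unfolding lcm_below_def by auto
qed

lemma head_division: "a # X \<approx> b # Y \<Longrightarrow> head_lcm a b X Y"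
  using lcm_belowD[OF lcm_below_all] by blast

lemma left_cancel: "p @ U \<approx> p @ V \<Longrightarrow> U \<approx> V"
  using cancel_below[OF lcm_below_all] by blast

text \<open>The length bound serves only as the induction measure: the common multiples to which the
  induction hypothesis is applied get shorter, but \<open>g\<close> and \<open>s\<close> may get longer.\<close>

lemma right_lcm:
  assumes "g @ d \<approx> s @ e" "length (g @ d) \<le> N"
  shows "\<exists>h k. g @ h \<approx> s @ k \<and> (\<forall>d e. g @ d \<approx> s @ e \<longrightarrow> (\<exists>d'. d \<approx> h @ d'))"
  using assms
proof (induction N arbitrary: g d s e)
  case 0
  then have "g = []" "s = []" using peq_length[of n M "g @ d" "s @ e"] by auto
  then show ?case by (intro exI[of _ "[]"]) auto
next
  case (Suc N)
  consider "s = []" | "g = []" | b g' y s' where "g = b # g'" "s = y # s'"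
    by (metis neq_Nil_conv)
  then show ?case
  proof cases
    case 1
    then show ?thesis by (intro exI[of _ "[]"] exI[of _ g]) auto
  next
    case 2
    then show ?thesis by (intro exI[of _ s] exI[of _ "[]"]) auto
  next
    case 3
    define t where "t = right_compl M b y"
    define t' where "t' = right_compl M y b"
    have hd: "head_lcm b y (g' @ d) (s' @ e)" if "g @ d \<approx> s @ e" for d e
      using head_division that 3 by auto
    have swap: "b # t \<approx> y # t'"
      using right_compl_eqv[of b y] hd[OF Suc.prems(1)] by (cases "b = y") (auto simp: head_lcm_def t_def t'_def)
    have div1: "\<exists>T. g' @ d \<approx> t @ T" if "g @ d \<approx> s @ e" for d e
      using hd[OF that] by (auto simp: head_lcm_def t_def)
    obtain h1 k1 where 1: "g' @ h1 \<approx> t @ k1"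
        "\<And>d e. g' @ d \<approx> t @ e \<Longrightarrow> \<exists>d'. d \<approx> h1 @ d'"
      using div1[OF Suc.prems(1)] Suc.IH[of g' d t] Suc.prems(2) 3 by (auto; blast)
    \<comment> \<open>\<open>g @ h1\<close> is the least common multiple of \<open>g\<close> and
      \<open>y\<close>, rewritten to begin with \<open>y\<close>. Cancelling \<open>y\<close> leaves
      a problem with \<open>s'\<close> in place of \<open>s\<close> and a shorter multiple.\<close>
    have gh1: "g @ h1 @ x \<approx> y # t' @ k1 @ x" for x
      using peq.ptrans[OF peq_Cons[OF peq_appR[OF 1(1), of x], of b] peq_appR[OF swap, of "k1 @ x", simplified, folded append_assoc]]
      by (simp add: 3)
    have div2: "\<exists>d1. d \<approx> h1 @ d1 \<and> t' @ k1 @ d1 \<approx> s' @ e" if "g @ d \<approx> s @ e" for d e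
    proof -
      from div1[OF that] obtain d1 where d1: "d \<approx> h1 @ d1" using 1(2) by blast
      have "y # t' @ k1 @ d1 \<approx> g @ h1 @ d1" by (rule peq.psym[OF gh1])
      also have "\<dots> \<approx> g @ d" by (rule peq_appL[OF peq.psym[OF d1]])
      also have "\<dots> \<approx> y # s' @ e" using that 3 by simp
      finally have "t' @ k1 @ d1 \<approx> s' @ e" using left_cancel[of "[y]"] by simp
      with d1 show ?thesis by blast
    qed
    obtain d1 where d1: "d \<approx> h1 @ d1" "t' @ k1 @ d1 \<approx> s' @ e" using div2[OF Suc.prems(1)] by blast
    have "length ((t' @ k1) @ d1) \<le> N"
      using peq_length[OF d1(2)] peq_length[OF Suc.prems(1)] Suc.prems(2) 3 by auto
    then obtain h2 k2 where 2: "t' @ k1 @ h2 \<approx> s' @ k2"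
        "\<And>d e. t' @ k1 @ d \<approx> s' @ e \<Longrightarrow> \<exists>d'. d \<approx> h2 @ d'"
      using Suc.IH[of "t' @ k1" d1 s' e] d1(2) by (simp only: append_assoc) blast
    have "g @ h1 @ h2 \<approx> s @ k2"
      using peq.ptrans[OF gh1 peq_Cons[OF 2(1)]] 3 by simp
    moreover have "\<exists>d'. d \<approx> (h1 @ h2) @ d'" if de: "g @ d \<approx> s @ e" for d e
    proof -
      obtain d1 where d1: "d \<approx> h1 @ d1" "t' @ k1 @ d1 \<approx> s' @ e" using div2[OF de] by blast
      obtain d2 where "d1 \<approx> h2 @ d2" using 2(2) d1(2) by blast
      then show ?thesis using peq.ptrans[OF d1(1) peq_appL[of _ _ d1 "h2 @ d2" h1]] by auto
    qed
    ultimately show ?thesis by blast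
  qed
qed

section \<open>The Garside element as a least common multiple\<close>

definition common_right_mult :: "nat list \<Rightarrow> bool" where
  "common_right_mult W \<longleftrightarrow> pos_word n W \<and> (\<forall>i<n. \<exists>u. i # u \<approx> W)"

text \<open>A longest common left divisor of a shortest common multiple \<open>D\<close> and of \<open>W\<close> is closed under
  taking the least common multiple with a generator, hence is itself a common multiple.\<close>

lemma least_common_right_mult:
  assumes "common_right_mult W0"
  shows "\<exists>D. common_right_mult D \<and> (\<forall>W. common_right_mult W \<longrightarrow> (\<exists>v. D @ v \<approx> W))"
proof -
  obtain D where D: "common_right_mult D" and min: "\<And>W. common_right_mult W \<Longrightarrow> length D \<le> length W"
    using ex_has_least_nat[of common_right_mult W0 length] assms by blast
  have "\<exists>v. D @ v \<approx> W" if W: "common_right_mult W" for W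
  proof -
    define Q where "Q = (\<lambda>g. (\<exists>d. g @ d \<approx> D) \<and> (\<exists>d. g @ d \<approx> W))"
    have "Q []" unfolding Q_def using peq.prefl by auto
    moreover have "length g \<le> length D" if "Q g" for g
      using that by (auto simp: Q_def dest!: peq_length)
    ultimately obtain g where g: "Q g" and max: "\<And>g'. Q g' \<Longrightarrow> length g' \<le> length g"
      using ex_has_greatest_nat[of Q "[]" length "Suc (length D)"] by (metis le_imp_less_Suc)
    obtain d d' where d: "g @ d \<approx> D" "g @ d' \<approx> W" using g by (auto simp: Q_def)
    have "\<exists>u. i # u \<approx> g" if i: "i < n" for i
    proof -
      obtain u u' where u: "i # u \<approx> D" "i # u' \<approx> W"
        using D W i unfolding common_right_mult_def by blast
      have e: "g @ d \<approx> [i] @ u" "g @ d' \<approx> [i] @ u'"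
        using peq.ptrans[OF d(1) peq.psym[OF u(1)]] peq.ptrans[OF d(2) peq.psym[OF u(2)]] by auto
      from right_lcm[OF e(1) order.refl] obtain h k where h: "g @ h \<approx> [i] @ k"
        "\<And>d e. g @ d \<approx> [i] @ e \<Longrightarrow> \<exists>d'. d \<approx> h @ d'" by blast
      obtain x x' where x: "d \<approx> h @ x" "d' \<approx> h @ x'" using h(2) e by blast
      have "(g @ h) @ x \<approx> D" "(g @ h) @ x' \<approx> W"
        using peq.ptrans[OF peq_appL[OF peq.psym[OF x(1)], of g] d(1)]
          peq.ptrans[OF peq_appL[OF peq.psym[OF x(2)], of g] d(2)] by auto
      then have "Q (g @ h)" by (auto simp: Q_def)
      then have "h = []" using max[of "g @ h"] by auto
      then show ?thesis using h(1) by (auto intro: peq.psym)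
    qed
    moreover have "pos_word n g"
      using peq_pos_word[OF d(1)] D by (auto simp: common_right_mult_def pos_word_def)
    ultimately have "length D \<le> length g" using min[of g] by (auto simp: common_right_mult_def)
    then have "length d = 0" using peq_length[OF d(1)] unfolding length_append by linarith
    then have "d = []" by simp
    then have "D @ d' \<approx> W" using peq.ptrans[OF peq_appR[OF peq.psym[OF d(1)], of d'] ] d(2) by auto
    then show ?thesis by blast
  qed
  with D show ?thesis by blast
qed

text \<open>\<open>j # D\<close> is divisible by every \<open>k\<close>, because \<open>D\<close> is divisible by the least common multiple
  of \<open>j\<close> and \<open>k\<close>; so it is a multiple of \<open>D\<close>, and the cofactor has length one.\<close>

lemma least_common_right_mult_quasi_central:
  assumes D: "common_right_mult D" and least: "\<And>W. common_right_mult W \<Longrightarrow> \<exists>v. D @ v \<approx> W"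
    and j: "j < n"
  shows "\<exists>j'<n. j # D \<approx> D @ [j']"
proof -
  have "\<exists>u. k # u \<approx> j # D" if k: "k < n" for k
  proof (cases "k = j")
    case False
    obtain u u' where u: "k # u \<approx> D" "j # u' \<approx> D"
      using D j k unfolding common_right_mult_def by blast
    then have "k # u \<approx> j # u'" using peq.ptrans peq.psym by metis
    then obtain r where "u \<approx> right_compl M k j @ r" using head_division unfolding head_lcm_def by blast
    then have Dr: "D \<approx> k # right_compl M k j @ r" by (metis peq_Cons peq.psym peq.ptrans u(1))
    obtain m where m: "M k j = Suc m" "M j k = Suc m"
      using ge2[OF k j False] sym[OF k j False] by (metis Suc_le_D numeral_2_eq_2)
    \<comment> \<open>The alternating word that starts with \<open>k\<close> is
      \<open>right_compl M j k\<close> with one more letter at the end. So \<open>D\<close> starts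
      with \<open>right_compl M j k\<close>, and a \<open>j\<close> put in front completes the least
      common multiple of \<open>j\<close> and \<open>k\<close>.\<close>
    have "k # right_compl M k j = right_compl M j k @ [if even m then k else j]"
      using m False alt_snoc[of k j m] by (simp add: right_compl_def)
    then have e: "k # right_compl M k j @ r = right_compl M j k @ (if even m then k else j) # r"
      by (metis append_Cons append_Nil append_assoc)
    have "j # D \<approx> j # right_compl M j k @ (if even m then k else j) # r"
      by (rule peq_Cons[OF Dr[unfolded e]])
    also have "\<dots> \<approx> k # right_compl M k j @ (if even m then k else j) # r"
      using peq_appR[OF right_compl_eqv[OF j k], of "(if even m then k else j) # r"] by simp
    finally show ?thesis by (blast intro: peq.psym)
  qed auto
  then have "common_right_mult (j # D)" using D j by (auto simp: common_right_mult_def pos_word_def)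
  then obtain v where v: "D @ v \<approx> j # D" using least by blast
  then have "length v = 1" using peq_length by fastforce
  then obtain j' where "v = [j']" by (auto simp: length_Suc_conv)
  moreover have "pos_word n v"
    using peq_pos_word[OF v] D j by (auto simp: common_right_mult_def pos_word_def)
  ultimately show ?thesis using v by (auto simp: pos_word_def intro: peq.psym)
qed

lemma common_left_mult_rev: "common_left_mult n M W \<longleftrightarrow> common_right_mult (rev W)"
proof -
  have 1: "(\<exists>u. pos_word n u \<and> u @ [i] \<approx> W) \<longleftrightarrow> (\<exists>u. i # u \<approx> rev W)" if "pos_word n W" for i
  proof
    assume "\<exists>u. pos_word n u \<and> u @ [i] \<approx> W"
    then show "\<exists>u. i # u \<approx> rev W" using peq_rev by fastforce
  next
    assume "\<exists>u. i # u \<approx> rev W"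
    then obtain u where u: "i # u \<approx> rev W" by blast
    then have "rev u @ [i] \<approx> W" using peq_rev[OF u] by simp
    moreover from this have "pos_word n (rev u)"
      using peq_pos_word[of n M "rev u @ [i]" W] that by (auto simp: pos_word_def)
    ultimately show "\<exists>u. pos_word n u \<and> u @ [i] \<approx> W" by blast
  qed
  show ?thesis unfolding common_left_mult_def common_right_mult_def using 1
    by (auto simp: pos_word_def)
qed

lemma is_garside_rev:
  "is_garside n M D \<longleftrightarrow> common_right_mult (rev D) \<and>
     (\<forall>W. common_right_mult W \<longrightarrow> (\<exists>v. rev D @ v \<approx> W))"
proof -
  have "(\<exists>v. pos_word n v \<and> v @ D \<approx> W) \<longleftrightarrow> (\<exists>v. rev D @ v \<approx> rev W)" if "pos_word n W" for W
  proof
    assume "\<exists>v. pos_word n v \<and> v @ D \<approx> W"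
    then show "\<exists>v. rev D @ v \<approx> rev W" using peq_rev by fastforce
  next
    assume "\<exists>v. rev D @ v \<approx> rev W"
    then obtain v where v: "rev D @ v \<approx> rev W" by blast
    then have "rev v @ D \<approx> W" using peq_rev[OF v] by simp
    moreover from this have "pos_word n (rev v)"
      using peq_pos_word[of n M "rev v @ D" W] that by (auto simp: pos_word_def)
    ultimately show "\<exists>v. pos_word n v \<and> v @ D \<approx> W" by blast
  qed
  then have "is_garside n M D \<longleftrightarrow> common_right_mult (rev D) \<and>
     (\<forall>W. common_right_mult (rev W) \<longrightarrow> (\<exists>v. rev D @ v \<approx> rev W))"
    unfolding is_garside_def common_left_mult_rev
    by (auto simp: common_right_mult_def pos_word_def)
  then show ?thesis by (metis rev_rev_ident)
qed

text \<open>The choice in \<open>garside\<close> has a meaning once a least common multiple exists,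
  and any common multiple \<open>W\<close> guarantees that.\<close>

lemma garside_quasi_central:
  assumes "common_right_mult W"
  shows "j < n \<Longrightarrow> \<exists>j'<n. garside n M @ [j] \<approx> j' # garside n M" and "pos_word n (garside n M)"
proof -
  obtain D where "is_garside n M (rev D)"
    using least_common_right_mult[OF assms] unfolding is_garside_rev by auto
  then have g: "is_garside n M (garside n M)" unfolding garside_def by (rule someI)
  then show "pos_word n (garside n M)" by (simp add: is_garside_def common_left_mult_def)
  show "\<exists>j'<n. garside n M @ [j] \<approx> j' # garside n M" if j: "j < n"
  proof -
    obtain j' where "j' < n" "j # rev (garside n M) \<approx> rev (garside n M) @ [j']"
      using least_common_right_mult_quasi_central[of "rev (garside n M)" j] g j
      unfolding is_garside_rev by blast
    then show ?thesis
      using peq_rev[of "j # rev (garside n M)" "rev (garside n M) @ [j']"] by auto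
  qed
qed

end

section \<open>Common multiples of the generators\<close>

lemma edge_label_sym: "edge_label es i j = edge_label es j i"
  by (induction es) (auto split: if_splits)

lemma edge_label_ge2: "(\<And>a b m. (a, b, m) \<in> set es \<Longrightarrow> m \<ge> 2) \<Longrightarrow> edge_label es i j \<ge> 2"
proof (induction es)
  case (Cons e es)
  obtain a b m where "e = (a, b, m)" by (cases e)
  with Cons show ?case by fastforce
qed simp

lemma edge_label_chain:
  "edge_label (chain_edges a b) i j =
     (if j = Suc i \<and> a \<le> i \<and> i < b \<or> i = Suc j \<and> a \<le> j \<and> j < b then 3 else 2)"
proof (induction "b - a" arbitrary: a)
  case 0
  then show ?case by (auto simp: chain_edges_def)
next
  case (Suc d)
  have "chain_edges a b = (a, Suc a, 3) # chain_edges (Suc a) b"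
    using Suc.hyps(2) by (auto simp: chain_edges_def upt_conv_Cons)
  moreover have "edge_label (chain_edges (Suc a) b) i j =
     (if j = Suc i \<and> Suc a \<le> i \<and> i < b \<or> i = Suc j \<and> Suc a \<le> j \<and> j < b then 3 else 2)"
    using Suc by (intro Suc.hyps(1)) auto
  ultimately show ?case using Suc.hyps(2) by auto
qed

lemma chain_edges_label: "(a, b, m) \<in> set (chain_edges x y) \<Longrightarrow> m = 3"
  by (auto simp: chain_edges_def)

lemma std_diag_ge2: "std_diag k es \<Longrightarrow> edge_label es i j \<ge> 2"
  by (rule edge_label_ge2)
    (auto simp: std_diag_def diag_A_def diag_B_def diag_D_def diag_E_def diag_F4_def diag_H_def
      diag_I2_def dest!: chain_edges_label)

lemma std_diag_sym_matrix: "std_diag k es \<Longrightarrow> sym_matrix k (edge_label es)"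
  by unfold_locales (auto intro: edge_label_sym std_diag_ge2)

text \<open>Any common multiple will do, as the least one is extracted from it. Its letters are kept
  in \<open>S\<close> so that the words of different components commute and can be
  concatenated.\<close>

definition has_mult :: "nat \<Rightarrow> (nat \<Rightarrow> nat \<Rightarrow> nat) \<Rightarrow> nat set \<Rightarrow> bool" where
  "has_mult n M S \<longleftrightarrow> (\<exists>W. set W \<subseteq> S \<and> (\<forall>i\<in>S. \<exists>u. peq n M (i # u) W))"

lemma has_multI:
  "set W \<subseteq> S \<Longrightarrow> (\<And>i. i \<in> S \<Longrightarrow> \<exists>u. peq n M (i # u) W) \<Longrightarrow> has_mult n M S"
  by (auto simp: has_mult_def)

lemma has_mult_relabel:
  assumes "has_mult k L {..<k}" and g: "inj_on g {..<k}" "g ` {..<k} \<subseteq> {..<n}"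
    "\<And>i j. i < k \<Longrightarrow> j < k \<Longrightarrow> i \<noteq> j \<Longrightarrow> M (g i) (g j) = L i j"
  shows "has_mult n M (g ` {..<k})"
proof -
  obtain W where W: "set W \<subseteq> {..<k}" "\<And>i. i < k \<Longrightarrow> \<exists>u. peq k L (i # u) W"
    using assms(1) by (auto simp: has_mult_def)
  have "\<exists>u. peq n M (g i # u) (map g W)" if i: "i < k" for i
  proof -
    obtain u where "peq k L (i # u) W" using W(2) i by blast
    from peq_relabel[of k L "i # u" W g n M, OF this g] show ?thesis by auto
  qed
  then show ?thesis using W(1) by (intro has_multI[of "map g W"]) auto
qed

section \<open>Ribbon words for the classical types\<close>

context sym_matrix
begin

lemma commute2: "a < n \<Longrightarrow> b < n \<Longrightarrow> a \<noteq> b \<Longrightarrow> M a b = 2 \<Longrightarrow> [a, b] \<approx> [b, a]"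
  using commute_word[of a "[b]"] by simp

lemma braid3: "a < n \<Longrightarrow> b < n \<Longrightarrow> a \<noteq> b \<Longrightarrow> M a b = 3 \<Longrightarrow> [a, b, a] \<approx> [b, a, b]"
  using peq.prel[of a n b M "[]" "[]"] by (simp add: numeral_3_eq_3)

lemma commute_word':
  assumes "c < n" and "\<And>x. x \<in> set p \<Longrightarrow> x < n \<and> x \<noteq> c \<and> M c x = 2"
  shows "x @ c # p @ y \<approx> x @ p @ c # y"
  using peq_append[of n M "c # p" "p @ [c]" x y] commute_word[of c p] assms by simp

lemma has_mult_Un:
  assumes "has_mult n M S" "has_mult n M T" "S \<subseteq> {..<n}" "T \<subseteq> {..<n}" "S \<inter> T = {}"
    "\<And>i j. i \<in> S \<Longrightarrow> j \<in> T \<Longrightarrow> M j i = 2"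
  shows "has_mult n M (S \<union> T)"
proof -
  obtain V where V: "set V \<subseteq> S" "\<And>i. i \<in> S \<Longrightarrow> \<exists>u. i # u \<approx> V"
    using assms(1) by (auto simp: has_mult_def)
  obtain W where W: "set W \<subseteq> T" "\<And>i. i \<in> T \<Longrightarrow> \<exists>u. i # u \<approx> W"
    using assms(2) by (auto simp: has_mult_def)
  have "\<exists>u. i # u \<approx> V @ W" if i: "i \<in> S" for i
  proof -
    obtain u where "i # u \<approx> V" using V(2) i by blast
    from peq_appR[OF this, of W] show ?thesis by auto
  qed
  moreover have "\<exists>u. i # u \<approx> V @ W" if i: "i \<in> T" for i
  proof -
    obtain u where "i # u \<approx> W" using W(2) i by blast
    then have "V @ i # u \<approx> V @ W" by (rule peq_appL)
    moreover have "i # V @ u \<approx> V @ i # u"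
      using commute_word'[of i V "[]" u] V(1) assms(3-6) i by fastforce
    ultimately show ?thesis by (blast intro: peq.ptrans)
  qed
  ultimately show ?thesis using V(1) W(1) by (intro has_multI[of "V @ W"]) auto
qed

text \<open>\<open>\<delta>\<close> carries each divisor \<open>i\<close> of \<open>W\<close> to the
  divisor \<open>\<sigma> i\<close> of \<open>\<delta> @ W\<close> and contributes its own first
  letter. In the classical types \<open>\<delta>\<close> is the quotient of the Garside elements of
  the diagram and of its subdiagram \<open>J\<close>.\<close>

lemma has_mult_ribbon:
  assumes "has_mult n M J" "J \<subseteq> {..<n}" "set \<delta> \<subseteq> {..<n}"
    and "\<And>i. i \<in> J \<Longrightarrow> \<delta> @ [i] \<approx> \<sigma> i # \<delta>"
    and "{..<n} \<subseteq> insert (hd \<delta>) (\<sigma> ` J)" "\<delta> \<noteq> []"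
  shows "has_mult n M {..<n}"
proof -
  obtain W where W: "set W \<subseteq> J" "\<And>i. i \<in> J \<Longrightarrow> \<exists>u. i # u \<approx> W"
    using assms(1) by (auto simp: has_mult_def)
  have "\<exists>u. \<sigma> i # u \<approx> \<delta> @ W" if i: "i \<in> J" for i
  proof -
    obtain u where "i # u \<approx> W" using W(2) i by blast
    then have "\<delta> @ i # u \<approx> \<delta> @ W" by (rule peq_appL)
    moreover have "\<sigma> i # \<delta> @ u \<approx> \<delta> @ i # u"
      using peq_appR[OF peq.psym[OF assms(4)[OF i]], of u] by simp
    ultimately show ?thesis by (blast intro: peq.ptrans)
  qed
  moreover have "\<exists>u. hd \<delta> # u \<approx> \<delta> @ W" using assms(6) by (intro exI[of _ "tl \<delta> @ W"]) (cases \<delta>, auto)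
  ultimately have "\<exists>u. i # u \<approx> \<delta> @ W" if "i < n" for i using that assms(5) by blast
  then show ?thesis using W(1) assms(2,3) by (intro has_multI[of "\<delta> @ W"]) auto
qed

definition chain :: "(nat \<Rightarrow> nat) \<Rightarrow> nat \<Rightarrow> bool" where
  "chain g r \<longleftrightarrow> (\<forall>i\<le>r. g i < n) \<and> inj_on g {..r} \<and> (\<forall>i<r. M (g i) (g (Suc i)) = 3) \<and>
     (\<forall>i j. j \<le> r \<longrightarrow> i + 2 \<le> j \<longrightarrow> M (g i) (g j) = 2)"

text \<open>The last letter moves left over the part of the chain that commutes with it, enters one
  braid relation, and goes on as \<open>g (Suc i)\<close> over the initial part.\<close>

lemma chain_shift:
  assumes "chain g r" "i < r"
  shows "map g [0..<Suc r] @ [g i] \<approx> g (Suc i) # map g [0..<Suc r]"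
proof -
  have lt: "\<And>i. i \<le> r \<Longrightarrow> g i < n" and inj: "\<And>i j. i \<le> r \<Longrightarrow> j \<le> r \<Longrightarrow> g i = g j \<longleftrightarrow> i = j"
    and m3: "\<And>i. i < r \<Longrightarrow> M (g i) (g (Suc i)) = 3"
    and m2: "\<And>i j. j \<le> r \<Longrightarrow> i + 2 \<le> j \<Longrightarrow> M (g i) (g j) = 2"
    using assms(1) by (auto simp: chain_def inj_on_def)
  have m2': "M (g j) (g i) = 2" if "j \<le> r" "i + 2 \<le> j" for i j
    using m2[OF that] sym[of "g i" "g j"] lt[of i] lt[of j] inj[of i j] that by auto
  define A where "A = map g [0..<i]"
  define B where "B = map g [Suc (Suc i)..<Suc r]"
  have "[0..<Suc r] = [0..<i] @ i # Suc i # [Suc (Suc i)..<Suc r]"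
    using assms(2) by (metis Suc_leI le_add1 le_SucI less_SucI upt_add_eq_append upt_conv_Cons
        add_0 le_add_diff_inverse less_imp_le Suc_less_eq)
  then have e: "map g [0..<Suc r] = A @ g i # g (Suc i) # B" by (simp add: A_def B_def)
  have A: "x < n \<and> x \<noteq> g (Suc i) \<and> M (g (Suc i)) x = 2" if x: "x \<in> set A" for x
  proof -
    obtain j where "x = g j" "j < i" using x by (auto simp: A_def)
    then show ?thesis using lt[of j] inj[of j "Suc i"] m2'[of "Suc i" j] assms(2) by auto
  qed
  have B: "x < n \<and> x \<noteq> g i \<and> M (g i) x = 2" if x: "x \<in> set B" for x
  proof -
    obtain j where "x = g j" "i + 2 \<le> j" "j \<le> r" using x by (auto simp: B_def simp del: upt_Suc)
    then show ?thesis using lt[of j] inj[of j i] m2[of j i] by auto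
  qed
  have "A @ g i # g (Suc i) # B @ [g i] \<approx> (A @ [g i, g (Suc i)]) @ g i # B @ []"
    using peq.psym[OF commute_word'[OF _ B, where x = "A @ [g i, g (Suc i)]" and y = "[]"]]
      lt[of i] assms(2) by simp
  also have "\<dots> \<approx> A @ [g (Suc i), g i, g (Suc i)] @ B"
    using peq_append[OF braid3[of "g i" "g (Suc i)"], of A B] lt inj m3 assms(2) by auto
  also have "\<dots> \<approx> [] @ g (Suc i) # A @ [g i, g (Suc i)] @ B"
    using peq.psym[OF commute_word'[OF _ A, where x = "[]" and y = "[g i, g (Suc i)] @ B"]]
      lt[of "Suc i"] assms(2) by simp
  finally show ?thesis unfolding e by simp
qed

text \<open>The letter descends to \<open>g s\<close> through \<open>rev up\<close>, by the mirror
  image of \<open>chain_shift\<close>, passes the centre \<open>c\<close>, and ascends again through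
  \<open>up\<close>.\<close>

lemma ribbon_interior:
  assumes "chain g r" "s < r" "\<And>x. x \<in> set c \<Longrightarrow> x < n \<and> x \<noteq> g s \<and> M (g s) x = 2"
  defines "up \<equiv> map g [0..<Suc r]"
  shows "(up @ c @ rev up) @ [g (Suc s)] \<approx> g (Suc s) # up @ c @ rev up"
proof -
  have sh: "up @ [g s] \<approx> g (Suc s) # up" unfolding up_def by (rule chain_shift[OF assms(1,2)])
  have "(up @ c) @ rev up @ [g (Suc s)] \<approx> (up @ c) @ g s # rev up"
    using peq_appL[OF peq.psym[OF peq_rev[OF sh]], of "up @ c"] by simp
  also have "\<dots> \<approx> up @ g s # c @ rev up"
    using peq.psym[OF commute_word'[of "g s" c up "rev up"]] assms(1-3) by (auto simp: chain_def)
  also have "\<dots> \<approx> g (Suc s) # up @ c @ rev up"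
    using peq_appR[OF sh, of "c @ rev up"] by simp
  finally show ?thesis by simp
qed

text \<open>The outer arms commute with both letters, so only the centre \<open>v\<close>
  matters.\<close>

lemma ribbon_end:
  assumes "x < n" "y < n" "(v @ [x]) \<approx> y # v"
    "\<And>z. z \<in> set p \<Longrightarrow> z < n \<and> z \<noteq> x \<and> M x z = 2" "\<And>z. z \<in> set p \<Longrightarrow> z < n \<and> z \<noteq> y \<and> M y z = 2"
  shows "(p @ v @ rev p) @ [x] \<approx> y # p @ v @ rev p"
proof -
  have "(p @ v) @ rev p @ x # [] \<approx> (p @ v) @ x # rev p @ []"
    by (rule peq.psym[OF commute_word']) (use assms in auto)
  also have "\<dots> \<approx> p @ y # v @ rev p" using peq_append[OF assms(3), of p "rev p"] by simp
  also have "\<dots> \<approx> [] @ y # p @ v @ rev p"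
    using peq.psym[OF commute_word'[of y p "[]" "v @ rev p"]] assms by auto
  finally show ?thesis by simp
qed

end

lemma has_mult_A: "has_mult k (edge_label (diag_A k)) {..<k}"
proof (induction k)
  case 0
  show ?case by (auto simp: has_mult_def)
next
  case (Suc k)
  have L: "edge_label (diag_A j) a b = (if a < j \<and> b < j \<and> (b = Suc a \<or> a = Suc b) then 3 else 2)" for j a b
    by (auto simp: diag_A_def edge_label_chain)
  interpret sym_matrix "Suc k" "edge_label (diag_A (Suc k))"
    by (rule std_diag_sym_matrix) (auto simp: std_diag_def)
  let ?E = "peq (Suc k) (edge_label (diag_A (Suc k)))"
  have 1: "has_mult (Suc k) (edge_label (diag_A (Suc k))) ((\<lambda>i. i) ` {..<k})"
    by (rule has_mult_relabel[OF Suc]) (auto simp: L)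
  have "chain (\<lambda>i. i) k" by (auto simp: chain_def L)
  from chain_shift[OF this]
  have sh: "?E ([0..<Suc k] @ [i]) (Suc i # [0..<Suc k])" if "i < k" for i using that by simp
  have "hd [0..<Suc k] = 0" by (simp add: upt_conv_Cons del: upt_Suc)
  then have ins: "i \<in> insert (hd [0..<Suc k]) (Suc ` {..<k})" if "i < Suc k" for i
    using that by (cases i) auto
  show ?case
    by (rule has_mult_ribbon[where J = "{..<k}" and \<delta> = "[0..<Suc k]" and \<sigma> = Suc])
      (use 1 sh ins in \<open>auto simp del: upt_Suc\<close>)
qed

text \<open>The new vertex \<open>k\<close> prolongs the chain. The word that runs from
  \<open>k\<close> down to 0 and back commutes with every smaller letter: at 0 by the relation of
  length four, elsewhere by shifting along the chain.\<close>

lemma has_mult_B: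
  assumes "k \<ge> 1"
  shows "has_mult k (edge_label (diag_B k)) {..<k}"
  using assms
proof (induction k rule: dec_induct)
  case base
  show ?case by (rule has_multI[of "[0]"]) auto
next
  case (step k)
  have L: "edge_label (diag_B j) a b = (if a = 0 \<and> b = 1 \<or> a = 1 \<and> b = 0 then 4 else
     if a < j \<and> b < j \<and> 1 \<le> a \<and> 1 \<le> b \<and> (b = Suc a \<or> a = Suc b) then 3 else 2)" for j a b
    by (simp add: diag_B_def edge_label_chain) arith
  interpret sym_matrix "Suc k" "edge_label (diag_B (Suc k))"
    by (rule std_diag_sym_matrix) (use step in \<open>auto simp: std_diag_def\<close>)
  let ?E = "peq (Suc k) (edge_label (diag_B (Suc k)))"
  have 1: "has_mult (Suc k) (edge_label (diag_B (Suc k))) ((\<lambda>i. i) ` {..<k})"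
    by (rule has_mult_relabel[OF step.IH]) (auto simp: L)
  \<comment> \<open>Decreasing numbering: \<open>up\<close> is k, k - 1, ..., 1, from the new vertex
    towards the edge of label 4.\<close>
  define g where "g = (\<lambda>t. k - t)"
  define up where "up = map g [0..<Suc (k - 1)]"
  have ch: "chain g (k - 1)" using step.hyps by (auto simp: chain_def L g_def inj_on_def)
  have c0: "?E ((up @ [0] @ rev up) @ [0]) (0 # up @ [0] @ rev up)"
  proof -
    have up: "up = map g [0..<k - 1] @ [1]" 
      unfolding up_def upt_Suc using step.hyps by (auto simp: g_def)
    have "?E ([1, 0, 1] @ [0]) (0 # [1, 0, 1])"
      using peq.prel[of 1 "Suc k" 0 "edge_label (diag_B (Suc k))" "[]" "[]"] step.hyps
      by (simp add: L numeral_eq_Suc)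
    then have "?E ((map g [0..<k - 1] @ [1, 0, 1] @ rev (map g [0..<k - 1])) @ [0])
        (0 # map g [0..<k - 1] @ [1, 0, 1] @ rev (map g [0..<k - 1]))"
      by (rule ribbon_end[rotated 2]) (use step.hyps in \<open>auto simp: L g_def\<close>)
    then show ?thesis by (simp add: up)
  qed
  have ci: "?E ((up @ [0] @ rev up) @ [i]) (i # up @ [0] @ rev up)" if "i < k" for i
  proof (cases "i = 0")
    case False
    have "g (Suc (k - Suc i)) = i" "g (k - Suc i) = Suc i" using that False by (auto simp: g_def)
    then show ?thesis
      using ribbon_interior[OF ch, of "k - Suc i" "[0]", folded up_def] that False by (auto simp: L)
  qed (use c0 in simp)
  have hd: "hd (up @ [0] @ rev up) = k" using step.hyps by (simp add: up_def g_def upt_conv_Cons del: upt_Suc)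
  show ?case
    by (rule has_mult_ribbon[where J = "{..<k}" and \<delta> = "up @ [0] @ rev up" and \<sigma> = "\<lambda>i. i", unfolded hd])
      (use 1 ci in \<open>auto simp: up_def g_def\<close>)
qed

text \<open>If reversing \<open>W\<close> against \<open>[i]\<close> adds nothing to
  \<open>W\<close>, then \<open>i\<close> divides \<open>W\<close>. Their least common multiple is
  then \<open>W\<close> itself, so \<open>Suc (length W)\<close> exceeds the recursion
  depth.\<close>

definition mult_check :: "nat \<Rightarrow> (nat \<times> nat \<times> nat) list \<Rightarrow> nat list \<Rightarrow> bool" where
  "mult_check k es W = list_all (\<lambda>i. case reversing (edge_label es) (Suc (length W)) W [i] of
     None \<Rightarrow> False | Some (s, t) \<Rightarrow> s = []) [0..<k]"

lemma has_mult_check: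
  assumes "sym_matrix k (edge_label es)" "mult_check k es W" "set W \<subseteq> {..<k}"
  shows "has_mult k (edge_label es) {..<k}"
proof -
  interpret sym_matrix k "edge_label es" by fact
  have "\<exists>u. peq k (edge_label es) (i # u) W" if i: "i < k" for i
  proof -
    have "case reversing (edge_label es) (Suc (length W)) W [i] of None \<Rightarrow> False | Some (s, t) \<Rightarrow> s = []"
      using assms(2) i by (auto simp: mult_check_def list_all_iff)
    then obtain t where "reversing (edge_label es) (Suc (length W)) W [i] = Some ([], t)"
      by (auto split: option.splits)
    from reversing_sound[where g = "\<lambda>x. x" and k = k, OF _ _ _ this] assms(3) i
    show ?thesis by (auto intro: peq.psym)
  qed
  then show ?thesis using assms(3) by (intro has_multI[of W]) auto
qed

text \<open>The words are \<open>c ^ (h div 2)\<close> for a bipartite Coxeter element \<open>c\<close> and the Coxeter number \<open>h\<close>.\<close>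

lemma mult_check_D4: "mult_check 4 [(1,3,3),(0,1,3),(1,2,3)] (concat (replicate 3 [0,2,3,1]))"
  by code_simp
lemma mult_check_H3: "mult_check 3 [(0,1,5),(1,2,3)] (concat (replicate 5 [0,2,1]))"
  by code_simp
lemma mult_check_F4: "mult_check 4 [(0,1,3),(1,2,4),(2,3,3)] (concat (replicate 6 [0,2,1,3]))"
  by code_simp
lemma mult_check_H4: "mult_check 4 [(0,1,5),(1,2,3),(2,3,3)] (concat (replicate 15 [0,2,1,3]))"
  by code_simp
lemma mult_check_E6: "mult_check 6 [(2,5,3),(0,1,3),(1,2,3),(2,3,3),(3,4,3)]
    (concat (replicate 6 [0,2,4,1,3,5]))"
  by code_simp
lemma mult_check_E7: "mult_check 7 [(2,6,3),(0,1,3),(1,2,3),(2,3,3),(3,4,3),(4,5,3)]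
    (concat (replicate 9 [0,2,4,1,3,5,6]))"
  by code_simp
lemma mult_check_E8: "mult_check 8 [(2,7,3),(0,1,3),(1,2,3),(2,3,3),(3,4,3),(4,5,3),(5,6,3)]
    (concat (replicate 15 [0,2,4,6,1,3,5,7]))"
  by code_simp

text \<open>The new vertex is the free end of the chain, so the old diagram embeds by
  \<open>Suc\<close>. The ribbon runs to the branch vertex, through both leaves, and back; it fixes
  the interior letters and exchanges the leaves, which gives \<open>\<sigma>\<close>.\<close>

lemma has_mult_D:
  assumes "k \<ge> 4"
  shows "has_mult k (edge_label (diag_D k)) {..<k}"
  using assms
proof (induction k rule: dec_induct)
  case base
  have "diag_D 4 = [(1,3,3),(0,1,3),(1,2,3)]"
    by (simp add: diag_D_def chain_edges_def upt_conv_Cons)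
  moreover have "sym_matrix 4 (edge_label (diag_D 4))"
    by (rule std_diag_sym_matrix) (simp add: std_diag_def)
  ultimately show ?case
    using has_mult_check[OF _ mult_check_D4] by (simp only:) (simp del: edge_label.simps)
next
  case (step k)
  obtain m where m: "k = m + 4" using step.hyps by (metis le_Suc_ex add.commute)
  have L0: "edge_label (diag_D k) a b = (if a = m + 1 \<and> b = m + 3 \<or> a = m + 3 \<and> b = m + 1 then 3 else
     if a \<le> m + 2 \<and> b \<le> m + 2 \<and> (b = Suc a \<or> a = Suc b) then 3 else 2)" for a b
    by (auto simp: diag_D_def edge_label_chain m)
  have L: "edge_label (diag_D (Suc k)) a b = (if a = m + 2 \<and> b = m + 4 \<or> a = m + 4 \<and> b = m + 2 then 3 else
     if a \<le> m + 3 \<and> b \<le> m + 3 \<and> (b = Suc a \<or> a = Suc b) then 3 else 2)" for a b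
    by (auto simp: diag_D_def edge_label_chain m)
  have lt: "x < Suc k \<longleftrightarrow> x < m + 5" for x by (auto simp: m)
  interpret sym_matrix "Suc k" "edge_label (diag_D (Suc k))"
    by (rule std_diag_sym_matrix) (use step in \<open>auto simp: std_diag_def\<close>)
  let ?E = "peq (Suc k) (edge_label (diag_D (Suc k)))"
  have 1: "has_mult (Suc k) (edge_label (diag_D (Suc k))) (Suc ` {..<k})"
    by (rule has_mult_relabel[OF step.IH]) (simp_all add: L L0 image_subset_iff)
  define up where "up = [0..<Suc (m + 2)]"
  let ?d = "up @ [m + 3, m + 4] @ rev up"
  have ch: "chain (\<lambda>i. i) (m + 2)" by (auto simp: chain_def L lt)
  have ci: "?E (?d @ [i]) (i # ?d)" if i: "i \<le> m + 2" "i \<ge> 1" for i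
  proof -
    obtain j where j: "i = Suc j" using i by (cases i) auto
    have "?E ((map (\<lambda>i. i) [0..<Suc (m + 2)] @ [m + 3, m + 4] @ rev (map (\<lambda>i. i) [0..<Suc (m + 2)])) @ [Suc j])
      (Suc j # map (\<lambda>i. i) [0..<Suc (m + 2)] @ [m + 3, m + 4] @ rev (map (\<lambda>i. i) [0..<Suc (m + 2)]))"
      by (rule ribbon_interior[OF ch]) (use i j in \<open>auto simp: L lt\<close>)
    then show ?thesis by (simp add: j up_def del: upt_Suc)
  qed
  have up: "up = [0..<m + 2] @ [m + 2]" by (simp add: up_def)
  define a b c where "a = m + 2" "b = m + 3" "c = m + 4"
  have abc: "a < Suc k" "b < Suc k" "c < Suc k" "a \<noteq> b" "a \<noteq> c" "b \<noteq> c"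
    by (auto simp: a_b_c_def lt)
  have br: "?E ([a, b, a]) ([b, a, b])" "?E ([a, c, a]) ([c, a, c])" "?E ([b, c]) ([c, b])"
    using braid3[of a b] braid3[of a c] commute2[of b c] abc by (simp_all add: L a_b_c_def)
  \<comment> \<open>With \<open>a\<close> the branch vertex and \<open>b\<close>, \<open>c\<close>
    the leaves, the centre \<open>a b c a\<close> exchanges \<open>b\<close> and
    \<open>c\<close>.\<close>
  have "?E ([a, b, c, a] @ [b]) ([a, c, b, a, b])" using peq_append[OF br(3), of "[a]" "[a, b]"] by simp
  also have "?E (\<dots>) ([a, c, a, b, a])" using peq_append[OF peq.psym[OF br(1)], of "[a, c]" "[]"] by simp
  also have "?E (\<dots>) ([c, a, c, b, a])" using peq_append[OF br(2), of "[]" "[b, a]"] by simp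
  also have "?E (\<dots>) (c # [a, b, c, a])" using peq_append[OF peq.psym[OF br(3)], of "[c, a]" "[a]"] by simp
  finally have e1: "?E ([a, b, c, a] @ [b]) (c # [a, b, c, a])" .
  have "?E ([a, b, c, a] @ [c]) ([a, b, a, c, a])" using peq_append[OF peq.psym[OF br(2)], of "[a, b]" "[]"] by simp
  also have "?E (\<dots>) (b # [a, b, c, a])" using peq_append[OF br(1), of "[]" "[c, a]"] by simp
  finally have e2: "?E ([a, b, c, a] @ [c]) (b # [a, b, c, a])" .
  have d: "?d = [0..<m + 2] @ [a, b, c, a] @ rev [0..<m + 2]" by (simp add: up a_b_c_def)
  have cb: "?E (?d @ [b]) (c # ?d)" unfolding d
    by (rule ribbon_end[OF _ _ e1]) (auto simp: L a_b_c_def lt)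
  have cc: "?E (?d @ [c]) (b # ?d)" unfolding d
    by (rule ribbon_end[OF _ _ e2]) (auto simp: L a_b_c_def lt)
  have hd: "hd ?d = 0" by (simp add: up_def upt_conv_Cons del: upt_Suc)
  define \<sigma> where "\<sigma> = (\<lambda>i. if i = b then c else if i = c then b else i)"
  have sg: "?E (?d @ [i]) (\<sigma> i # ?d)" if "i \<in> Suc ` {..<k}" for i
  proof -
    have "i = b \<or> i = c \<or> (1 \<le> i \<and> i \<le> m + 2)" using that by (auto simp: a_b_c_def m)
    then show ?thesis using ci[of i] cb cc abc by (auto simp: \<sigma>_def a_b_c_def)
  qed
  have ins: "i \<in> insert (hd ?d) (\<sigma> ` Suc ` {..<k})" if "i < Suc k" for i
  proof (cases "i = 0")
    case False
    have "\<sigma> i \<noteq> 0 \<and> \<sigma> i < Suc k" using that False by (auto simp: \<sigma>_def a_b_c_def lt)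
    then have "\<sigma> i \<in> Suc ` {..<k}" by (cases "\<sigma> i") auto
    moreover have "\<sigma> (\<sigma> i) = i" by (auto simp: \<sigma>_def)
    ultimately show ?thesis by (metis imageI insertI2)
  qed (use hd in simp)
  show ?case
  proof (rule has_mult_ribbon[OF 1 _ _ sg])
    show "set ?d \<subseteq> {..<Suc k}" by (auto simp: up_def m)
  qed (use ins in blast)+
qed

lemma has_mult_I2: "p \<ge> 1 \<Longrightarrow> has_mult 2 (edge_label (diag_I2 p)) {..<2}"
proof -
  assume "p \<ge> 1"
  then obtain m where m: "p = Suc m" by (cases p) auto
  have "peq 2 (edge_label (diag_I2 p)) (1 # alt 0 1 m) (alt 0 1 p)"
    using peq.prel[of 1 2 0 "edge_label (diag_I2 p)" "[]" "[]"] by (simp add: diag_I2_def m)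
  moreover have "peq 2 (edge_label (diag_I2 p)) (0 # alt 1 0 m) (alt 0 1 p)" by (simp add: m)
  moreover have "set (alt 0 1 p) \<subseteq> {..<2}" using set_alt[of 0 1 p] by auto
  moreover have "i < 2 \<longleftrightarrow> i = 0 \<or> i = 1" for i :: nat by auto
  ultimately show ?thesis unfolding has_mult_def by (metis lessThan_iff)
qed

lemma diag_E_eq:
  "diag_E 6 = [(2,5,3),(0,1,3),(1,2,3),(2,3,3),(3,4,3)]"
  "diag_E 7 = [(2,6,3),(0,1,3),(1,2,3),(2,3,3),(3,4,3),(4,5,3)]"
  "diag_E 8 = [(2,7,3),(0,1,3),(1,2,3),(2,3,3),(3,4,3),(4,5,3),(5,6,3)]"
  by (simp_all add: diag_E_def chain_edges_def upt_conv_Cons)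

lemma diag_H_eq:
  "diag_H 3 = [(0,1,5),(1,2,3)]" "diag_H 4 = [(0,1,5),(1,2,3),(2,3,3)]"
  by (simp_all add: diag_H_def chain_edges_def upt_conv_Cons)

lemma has_mult_std:
  assumes "std_diag k es"
  shows "has_mult k (edge_label es) {..<k}"
proof -
  have s: "sym_matrix k (edge_label es)" by (rule std_diag_sym_matrix[OF assms])
  show ?thesis
    using assms has_mult_A[of k] has_mult_B[of k] has_mult_D[of k] has_mult_I2
      has_mult_check[OF _ mult_check_E6] has_mult_check[OF _ mult_check_E7]
      has_mult_check[OF _ mult_check_E8] has_mult_check[OF _ mult_check_F4]
      has_mult_check[OF _ mult_check_H3] has_mult_check[OF _ mult_check_H4] s
    unfolding std_diag_def
    by (elim disjE conjE exE insertE emptyE) (simp_all add: diag_E_eq diag_H_eq diag_F4_def)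
qed

section \<open>Three-generator subdiagrams of the finite types\<close>

definition triple_ok :: "nat \<Rightarrow> nat \<Rightarrow> nat \<Rightarrow> bool" where
  "triple_ok x y z \<longleftrightarrow> x = 2 \<and> y = 2 \<or> x = 2 \<and> z = 2 \<or> y = 2 \<and> z = 2 \<or> (x, y, z) \<in> set rank3_labels"

text \<open>No triangle and at most one label above 3: if two edges remain, the type is A_3, B_3 or
  H_3 in some numbering.\<close>

lemma triple_ok_I:
  assumes "x \<in> {2, 3, 4, 5}" "y \<in> {2, 3, 4, 5}" "z \<in> {2, 3, 4, 5}" "x = 2 \<or> y = 2 \<or> z = 2"
    "x \<le> 3 \<or> y \<le> 3" "x \<le> 3 \<or> z \<le> 3" "y \<le> 3 \<or> z \<le> 3"
  shows "triple_ok x y z"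
proof -
  have *: "triple_ok 2 a b \<and> triple_ok a 2 b \<and> triple_ok a b 2"
    if "a \<in> {2, 3, 4, 5}" "b \<in> {2, 3, 4, 5}" "a \<le> 3 \<or> b \<le> 3" for a b
    using that by (elim insertE emptyE) (simp_all add: triple_ok_def rank3_labels_def)
  show ?thesis
    using *[OF assms(1,2,5)] *[OF assms(1,3,6)] *[OF assms(2,3,7)] assms(4) by blast
qed

text \<open>\<open>s\<close> is the sum of the end points of the one edge whose label may exceed 3;
  two edges of a triple share a vertex, so their sums differ. A triangle would need three pairwise
  consecutive numbers.\<close>

lemma triple_ok_chain:
  assumes "distinct [i, j, l]"
    and "\<And>a b. e a b \<in> {2, 3, 4, 5}" "\<And>a b. e a b \<noteq> 2 \<Longrightarrow> b = Suc a \<or> a = Suc b"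
    and "\<And>a b. e a b > 3 \<Longrightarrow> a + b = s"
  shows "triple_ok (e i j) (e i l) (e j l)"
proof (rule triple_ok_I)
  show "e i j = 2 \<or> e i l = 2 \<or> e j l = 2"
    using assms(3)[of i j] assms(3)[of i l] assms(3)[of j l] by linarith
  have "i \<noteq> j" "i \<noteq> l" "j \<noteq> l" using assms(1) by auto
  then show "e i j \<le> 3 \<or> e i l \<le> 3" "e i j \<le> 3 \<or> e j l \<le> 3" "e i l \<le> 3 \<or> e j l \<le> 3"
    using assms(4)[of i j] assms(4)[of i l] assms(4)[of j l] by linarith+
qed (rule assms(2))+

lemma triple_ok_marked_chain:
  assumes "distinct [i, j, l]" "q \<in> {3, 4, 5}"
  shows "triple_ok (edge_label ((0, 1, q) # chain_edges 1 b) i j) (edge_label ((0, 1, q) # chain_edges 1 b) i l)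
    (edge_label ((0, 1, q) # chain_edges 1 b) j l)"
  by (rule triple_ok_chain[where s = 1, OF assms(1)])
    (use assms(2) in \<open>auto simp: edge_label_chain split: if_splits\<close>)

lemma triple_ok_A:
  assumes "distinct [i, j, l]"
  shows "triple_ok (edge_label (diag_A k) i j) (edge_label (diag_A k) i l) (edge_label (diag_A k) j l)"
  by (rule triple_ok_chain[where s = 0, OF assms]) (auto simp: diag_A_def edge_label_chain split: if_splits)

lemma triple_ok_F4:
  assumes "distinct [i, j, l]"
  shows "triple_ok (edge_label diag_F4 i j) (edge_label diag_F4 i l) (edge_label diag_F4 j l)"
  by (rule triple_ok_chain[where s = 3, OF assms]) (auto simp: diag_F4_def split: if_splits)

text \<open>Types D and E in one form: a path from 0 to \<open>t\<close> with a leaf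
  \<open>Suc t\<close> attached at \<open>b\<close>. A triangle would contain the leaf, which has a
  single neighbour, or consist of pairwise consecutive vertices.\<close>

lemma triple_ok_forked_chain:
  assumes "distinct [i, j, l]" "b < t" "es = (b, Suc t, 3) # chain_edges 0 t"
  shows "triple_ok (edge_label es i j) (edge_label es i l) (edge_label es j l)"
proof (rule triple_ok_I)
  have r: "edge_label es x y \<in> {2, 3}" for x y by (simp add: assms(3) edge_label_chain)
  show "edge_label es i j \<le> 3 \<or> edge_label es i l \<le> 3" "edge_label es i j \<le> 3 \<or> edge_label es j l \<le> 3"
    "edge_label es i l \<le> 3 \<or> edge_label es j l \<le> 3" using r[of i j] r[of i l] by auto
  show "edge_label es i j \<in> {2, 3, 4, 5}" "edge_label es i l \<in> {2, 3, 4, 5}" "edge_label es j l \<in> {2, 3, 4, 5}"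
    using r by blast+
  have nb: "(x = Suc t \<longrightarrow> y = b) \<and> (y = Suc t \<longrightarrow> x = b) \<and>
      (x \<noteq> Suc t \<longrightarrow> y \<noteq> Suc t \<longrightarrow> y = Suc x \<or> x = Suc y)" if "edge_label es x y \<noteq> 2" for x y
  proof -
    have "b = x \<and> Suc t = y \<or> b = y \<and> Suc t = x \<or> edge_label (chain_edges 0 t) x y \<noteq> 2"
      using that by (auto simp: assms(3) split: if_splits)
    moreover have "y = Suc x \<and> y < Suc t \<or> x = Suc y \<and> x < Suc t"
      if "edge_label (chain_edges 0 t) x y \<noteq> 2"
      using that unfolding edge_label_chain by (auto split: if_splits)
    ultimately show ?thesis using assms(2) by auto
  qed
  show "edge_label es i j = 2 \<or> edge_label es i l = 2 \<or> edge_label es j l = 2"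
  proof (rule ccontr)
    assume "\<not> ?thesis"
    then have "edge_label es i j \<noteq> 2" "edge_label es i l \<noteq> 2" "edge_label es j l \<noteq> 2" by auto
    note e = nb[OF this(1)] nb[OF this(2)] nb[OF this(3)]
    have d: "i \<noteq> j" "i \<noteq> l" "j \<noteq> l" using assms(1) by auto
    consider "i = Suc t" | "j = Suc t" | "l = Suc t" | "Suc t \<notin> {i, j, l}" by blast
    then show False
    proof cases
      case 4
      then have "j = Suc i \<or> i = Suc j" "l = Suc i \<or> i = Suc l" "l = Suc j \<or> j = Suc l"
        using e by blast+
      then show False by linarith
    qed (use e d in metis)+
  qed
qed

lemma triple_ok_std:
  assumes "std_diag k es" "i < k" "j < k" "l < k" "distinct [i, j, l]"
  shows "triple_ok (edge_label es i j) (edge_label es i l) (edge_label es j l)"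
proof -
  \<comment> \<open>Three distinct vertices exclude rank two, and with it the unbounded labels of
    I_2(p).\<close>
  have "k \<noteq> 2" using assms(2-5) by auto
  with assms(1) consider "es = diag_A k"
    | q where "q \<in> {3, 4, 5}" "es = (0, 1, q) # chain_edges 1 (k - 1)"
    | b t where "b < t" "es = (b, Suc t, 3) # chain_edges 0 t" | "es = diag_F4"
    unfolding std_diag_def diag_B_def diag_D_def diag_E_def diag_H_def
  proof (elim disjE conjE exE, goal_cases)
    case 2
    show ?case by (rule 2(2)[of 4]) (use 2 in simp_all)
  next
    case 3
    have "k - 3 < k - 2" "k - 1 = Suc (k - 2)" using \<open>4 \<le> k\<close> by auto
    then show ?case using 3(3) \<open>es = _\<close> by metis
  next
    case 4
    have "2 < k - 2" "k - 1 = Suc (k - 2)" using \<open>k \<in> _\<close> by auto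
    then show ?case using 4(3) \<open>es = _\<close> by metis
  next
    case 7
    show ?case by (rule 7(2)[of 5]) (use 7 in simp_all)
  qed simp_all
  then show ?thesis
    by cases (use triple_ok_A triple_ok_marked_chain triple_ok_forked_chain triple_ok_F4 assms(5) in auto)
qed

section \<open>Assembling the connected components\<close>

definition components :: "nat \<Rightarrow> (nat \<Rightarrow> nat \<Rightarrow> nat) \<Rightarrow> nat set set \<Rightarrow> bool" where
  "components n M P \<longleftrightarrow> \<Union>P = {..<n} \<and> (\<forall>C\<in>P. \<forall>D\<in>P. C \<noteq> D \<longrightarrow> C \<inter> D = {}) \<and>
     (\<forall>C\<in>P. \<forall>D\<in>P. C \<noteq> D \<longrightarrow> (\<forall>i\<in>C. \<forall>j\<in>D. M i j = 2)) \<and>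
     (\<forall>C\<in>P. \<exists>f es. bij_betw f C {..<card C} \<and> std_diag (card C) es \<and>
        (\<forall>i\<in>C. \<forall>j\<in>C. i \<noteq> j \<longrightarrow> M i j = edge_label es (f i) (f j)))"

lemma spherical_components: "spherical n M \<Longrightarrow> \<exists>P. components n M P"
  unfolding spherical_def components_def diag_lab_eq_edge_label by (elim exE conjE, intro exI conjI)

lemma componentsD:
  assumes "components n M P"
  shows "\<Union>P = {..<n}" "finite P" "\<And>C D. C \<in> P \<Longrightarrow> D \<in> P \<Longrightarrow> C \<noteq> D \<Longrightarrow> C \<inter> D = {}"
    "\<And>C D i j. C \<in> P \<Longrightarrow> D \<in> P \<Longrightarrow> C \<noteq> D \<Longrightarrow> i \<in> C \<Longrightarrow> j \<in> D \<Longrightarrow> M i j = 2"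
    "\<And>C. C \<in> P \<Longrightarrow> \<exists>f es. bij_betw f C {..<card C} \<and> std_diag (card C) es \<and>
        (\<forall>i\<in>C. \<forall>j\<in>C. i \<noteq> j \<longrightarrow> M i j = edge_label es (f i) (f j))"
proof -
  show U: "\<Union>P = {..<n}" using assms by (simp add: components_def)
  show "finite P" using U by (intro finite_UnionD) simp
qed (use assms in \<open>simp_all add: components_def\<close>)

lemma spherical_spherical_triples:
  assumes "spherical n M"
  shows "spherical_triples n M"
proof -
  obtain P where cm: "components n M P" using spherical_components[OF assms] by blast
  note P = componentsD(1,2)[OF cm] and disj = componentsD(3)[OF cm]
    and cross = componentsD(4)[OF cm] and std = componentsD(5)[OF cm]
  have cmpt: "\<exists>C\<in>P. i \<in> C" if "i < n" for i using P that by auto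
  have within: "M i j = M j i \<and> M i j \<ge> 2" if "C \<in> P" "i \<in> C" "j \<in> C" "i \<noteq> j" for C i j
    using std[OF that(1)] that(2-) edge_label_sym std_diag_ge2 by metis
  show ?thesis
  proof
    fix i j assume ij: "i < n" "j < n" "i \<noteq> j"
    obtain C D where CD: "C \<in> P" "D \<in> P" "i \<in> C" "j \<in> D" using cmpt ij by blast
    show "M i j = M j i" using within cross CD ij(3) by metis
    show "M i j \<ge> 2" using within cross CD ij(3) by (metis order.refl)
  next
    fix a b c assume abc: "a < n" "b < n" "c < n" "distinct [a, b, c]"
    obtain A B C where ABC: "A \<in> P" "B \<in> P" "C \<in> P" "a \<in> A" "b \<in> B" "c \<in> C"
      using cmpt[OF abc(1)] cmpt[OF abc(2)] cmpt[OF abc(3)] by (elim bexE)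
    have "triple_ok (M a b) (M a c) (M b c)"
    proof (cases "A = B \<and> B = C")
      case True
      then have m: "a \<in> A" "b \<in> A" "c \<in> A" using ABC by auto
      obtain f es where f: "bij_betw f A {..<card A}" "std_diag (card A) es"
        "\<forall>i\<in>A. \<forall>j\<in>A. i \<noteq> j \<longrightarrow> M i j = edge_label es (f i) (f j)" using std[OF ABC(1)] by blast
      have "f x < card A" if "x \<in> A" for x using f(1) that by (auto dest: bij_betwE)
      moreover have "distinct [f a, f b, f c]"
        using f(1) m abc(4) by (auto simp: bij_betw_def inj_on_def)
      ultimately have "triple_ok (edge_label es (f a) (f b)) (edge_label es (f a) (f c)) (edge_label es (f b) (f c))"
        using triple_ok_std[OF f(2)] m by blast
      then show ?thesis using f(3) m abc(4) by auto
    next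
      \<comment> \<open>One of the letters lies in a component that contains neither of the others,
        so both of its labels are 2.\<close>
      case False
      then show ?thesis using cross ABC unfolding triple_ok_def by metis
    qed
    then show "M a b = 2 \<and> M a c = 2 \<or> M a b = 2 \<and> M b c = 2 \<or> M a c = 2 \<and> M b c = 2 \<or>
      (M a b, M a c, M b c) \<in> set rank3_labels" unfolding triple_ok_def .
  qed
qed

lemma spherical_has_mult:
  assumes "spherical n M"
  shows "has_mult n M {..<n}"
proof -
  interpret spherical_triples n M by (rule spherical_spherical_triples[OF assms])
  obtain P where cm: "components n M P" using spherical_components[OF assms] by blast
  note P = componentsD(1,2)[OF cm] and disj = componentsD(3)[OF cm]
    and cross = componentsD(4)[OF cm] and std = componentsD(5)[OF cm]
  have one: "has_mult n M C" if C: "C \<in> P" for C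
  proof -
    obtain f es where f: "bij_betw f C {..<card C}" "std_diag (card C) es"
      "\<forall>i\<in>C. \<forall>j\<in>C. i \<noteq> j \<longrightarrow> M i j = edge_label es (f i) (f j)" using std[OF C] by blast
    define g where "g = inv_into C f"
    have g: "bij_betw g {..<card C} C" unfolding g_def by (rule bij_betw_inv_into[OF f(1)])
    have fg: "f (g i) = i" "g i \<in> C" if "i < card C" for i
      using f(1) g that by (auto simp: g_def bij_betw_def f_inv_into_f inv_into_into)
    have "has_mult n M (g ` {..<card C})"
    proof (rule has_mult_relabel[OF has_mult_std[OF f(2)]])
      show "inj_on g {..<card C}" using g by (rule bij_betw_imp_inj_on)
      show "g ` {..<card C} \<subseteq> {..<n}" using g C P(1) by (auto simp: bij_betw_def)
      show "M (g i) (g j) = edge_label es i j" if "i < card C" "j < card C" "i \<noteq> j" for i j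
        using f(3) fg that by metis
    qed
    then show ?thesis using g by (simp add: bij_betw_def)
  qed
  have "has_mult n M (\<Union>Q)" if "Q \<subseteq> P" for Q
    using finite_subset[OF that P(2)] that
  proof (induction rule: finite_induct)
    case empty
    show ?case by (rule has_multI[of "[]"]) auto
  next
    case (insert C Q)
    have "has_mult n M (C \<union> \<Union>Q)"
    proof (rule has_mult_Un)
      show "C \<inter> \<Union>Q = {}" using disj insert by blast
      show "M j i = 2" if "i \<in> C" "j \<in> \<Union>Q" for i j using cross insert that by blast
      show "C \<subseteq> {..<n}" "\<Union>Q \<subseteq> {..<n}" using P(1) insert by blast+
    qed (use insert one in auto)
    then show ?case by simp
  qed
  from this[OF order.refl] show ?thesis using P(1) by simp
qed

lemma spherical_garside:
  assumes "spherical n M"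
  shows "j < n \<Longrightarrow> \<exists>j'<n. peq n M (garside n M @ [j]) (j' # garside n M)"
    and "pos_word n (garside n M)"
proof -
  interpret spherical_triples n M by (rule spherical_spherical_triples[OF assms])
  obtain W where "common_right_mult W"
    using spherical_has_mult[OF assms] by (auto simp: has_mult_def common_right_mult_def pos_word_def)
  note garside_quasi_central[OF this]
  then show "j < n \<Longrightarrow> \<exists>j'<n. peq n M (garside n M @ [j]) (j' # garside n M)"
    and "pos_word n (garside n M)" by auto
qed

section \<open>Counting normal words\<close>

text \<open>The weights \<open>\<phi>\<close> witness that the transition matrix of the normal words below, restricted to \<open>S\<close>,
  has spectral radius less than 4.\<close>

definition subcritical :: "(nat \<Rightarrow> nat \<Rightarrow> nat) \<Rightarrow> nat set \<Rightarrow> bool" where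
  "subcritical M S \<longleftrightarrow> (\<exists>\<rho> :: nat \<Rightarrow> nat. \<exists>\<phi> :: nat \<Rightarrow> real. \<forall>i\<in>S. \<phi> i > 0 \<and>
     sum \<phi> {j \<in> S. \<rho> i \<le> \<rho> j \<or> M i j \<noteq> 2} < 4 * \<phi> i)"

text \<open>Since the weights are positive, the set of possible followers may be enlarged to a
  convenient \<open>N i\<close>, such as an interval over which the weights telescope.\<close>

lemma subcriticalI:
  fixes \<rho> :: "nat \<Rightarrow> nat" and \<phi> :: "nat \<Rightarrow> real"
  assumes "\<And>i. i \<in> S \<Longrightarrow> \<phi> i > 0" "\<And>i. i \<in> S \<Longrightarrow> sum \<phi> (N i) < 4 * \<phi> i"
    "\<And>i j. i \<in> S \<Longrightarrow> j \<in> S \<Longrightarrow> \<rho> i \<le> \<rho> j \<or> M i j \<noteq> 2 \<Longrightarrow> j \<in> N i"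
    "\<And>i. i \<in> S \<Longrightarrow> finite (N i) \<and> N i \<subseteq> S"
  shows "subcritical M S"
  unfolding subcritical_def
proof (intro exI[of _ \<rho>] exI[of _ \<phi>] ballI conjI)
  fix i assume i: "i \<in> S"
  show "\<phi> i > 0" using assms(1) i .
  have "sum \<phi> {j \<in> S. \<rho> i \<le> \<rho> j \<or> M i j \<noteq> 2} \<le> sum \<phi> (N i)"
  proof (rule sum_mono2)
    fix j assume "j \<in> N i - {j \<in> S. \<rho> i \<le> \<rho> j \<or> M i j \<noteq> 2}"
    then have "j \<in> S" using assms(4)[OF i] by blast
    then show "0 \<le> \<phi> j" using assms(1) by (simp add: less_imp_le)
  qed (use assms(3,4) i in auto)
  then show "sum \<phi> {j \<in> S. \<rho> i \<le> \<rho> j \<or> M i j \<noteq> 2} < 4 * \<phi> i" using assms(2)[OF i] by simp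
qed

lemma subcritical_relabel:
  assumes "subcritical L {..<k}" "bij_betw f C {..<k}"
    and "\<And>i j. i \<in> C \<Longrightarrow> j \<in> C \<Longrightarrow> i \<noteq> j \<Longrightarrow> M i j = L (f i) (f j)"
  shows "subcritical M C"
proof -
  obtain \<rho> :: "nat \<Rightarrow> nat" and \<phi> :: "nat \<Rightarrow> real" where *: "\<And>i. i < k \<Longrightarrow> \<phi> i > 0"
    "\<And>i. i < k \<Longrightarrow> sum \<phi> {j \<in> {..<k}. \<rho> i \<le> \<rho> j \<or> L i j \<noteq> 2} < 4 * \<phi> i"
    using assms(1) by (auto simp: subcritical_def)
  have f: "f i < k" if "i \<in> C" for i using assms(2) that by (auto dest: bij_betwE)
  show ?thesis
  proof (rule subcriticalI[where \<rho> = "\<rho> \<circ> f" and \<phi> = "\<phi> \<circ> f" and N = "\<lambda>i. {j \<in> C. \<rho> (f i) \<le> \<rho> (f j) \<or> L (f i) (f j) \<noteq> 2}"])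
    fix i assume i: "i \<in> C"
    show "(\<phi> \<circ> f) i > 0" using *(1) f i by simp
    have "bij_betw f {j \<in> C. \<rho> (f i) \<le> \<rho> (f j) \<or> L (f i) (f j) \<noteq> 2} {j \<in> {..<k}. \<rho> (f i) \<le> \<rho> j \<or> L (f i) j \<noteq> 2}"
      using assms(2) by (auto simp: bij_betw_def inj_on_def image_iff)
    then have "sum (\<phi> \<circ> f) {j \<in> C. \<rho> (f i) \<le> \<rho> (f j) \<or> L (f i) (f j) \<noteq> 2} =
        sum \<phi> {j \<in> {..<k}. \<rho> (f i) \<le> \<rho> j \<or> L (f i) j \<noteq> 2}"
      unfolding comp_def by (rule sum.reindex_bij_betw)
    then show "sum (\<phi> \<circ> f) {j \<in> C. \<rho> (f i) \<le> \<rho> (f j) \<or> L (f i) (f j) \<noteq> 2} < 4 * (\<phi> \<circ> f) i"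
      using *(2)[OF f[OF i]] by simp
    have "finite C" using assms(2) bij_betw_finite by blast
    then show "finite {j \<in> C. \<rho> (f i) \<le> \<rho> (f j) \<or> L (f i) (f j) \<noteq> 2} \<and>
        {j \<in> C. \<rho> (f i) \<le> \<rho> (f j) \<or> L (f i) (f j) \<noteq> 2} \<subseteq> C" by auto
  next
    fix i j assume "i \<in> C" "j \<in> C" "(\<rho> \<circ> f) i \<le> (\<rho> \<circ> f) j \<or> M i j \<noteq> 2"
    then show "j \<in> {j \<in> C. \<rho> (f i) \<le> \<rho> (f j) \<or> L (f i) (f j) \<noteq> 2}"
      using assms(3) by (cases "i = j") auto
  qed
qed

text \<open>Normal words never return from \<open>T\<close> to \<open>S\<close>, so scaling down the weights on \<open>T\<close> keeps the
  inequalities on \<open>S\<close> strict.\<close>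

lemma subcritical_Un:
  assumes "subcritical M S" "subcritical M T" "finite S" "finite T" "S \<inter> T = {}"
    "\<And>i j. i \<in> S \<Longrightarrow> j \<in> T \<Longrightarrow> M j i = 2"
  shows "subcritical M (S \<union> T)"
proof -
  obtain \<rho> :: "nat \<Rightarrow> nat" and \<phi> :: "nat \<Rightarrow> real" where S: "\<And>i. i \<in> S \<Longrightarrow> \<phi> i > 0"
    "\<And>i. i \<in> S \<Longrightarrow> sum \<phi> {j \<in> S. \<rho> i \<le> \<rho> j \<or> M i j \<noteq> 2} < 4 * \<phi> i"
    using assms(1) by (auto simp: subcritical_def)
  obtain \<rho>' :: "nat \<Rightarrow> nat" and \<phi>' :: "nat \<Rightarrow> real" where T: "\<And>i. i \<in> T \<Longrightarrow> \<phi>' i > 0"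
    "\<And>i. i \<in> T \<Longrightarrow> sum \<phi>' {j \<in> T. \<rho>' i \<le> \<rho>' j \<or> M i j \<noteq> 2} < 4 * \<phi>' i"
    using assms(2) by (auto simp: subcritical_def)
  define gap where "gap = (\<lambda>i. 4 * \<phi> i - sum \<phi> {j \<in> S. \<rho> i \<le> \<rho> j \<or> M i j \<noteq> 2})"
  define B where "B = sum \<phi>' T"
  have B: "B \<ge> 0" unfolding B_def using T(1) by (intro sum_nonneg) (auto intro: less_imp_le)
  \<comment> \<open>The inserted 1 covers an empty \<open>S\<close>, and \<open>B + 1\<close> avoids
    a division by zero; the scaled total weight \<open>\<epsilon> * B\<close> of \<open>T\<close>
    stays below every gap.\<close>
  define \<epsilon> where "\<epsilon> = Min (insert 1 (gap ` S)) / (2 * (B + 1))"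
  have m: "Min (insert 1 (gap ` S)) > 0" using S(2) assms(3) by (auto simp: gap_def)
  then have e: "\<epsilon> > 0" using B by (simp add: \<epsilon>_def)
  have eB: "\<epsilon> * B < gap i" if "i \<in> S" for i
  proof -
    have "\<epsilon> * B < \<epsilon> * (2 * (B + 1))" using e B by (intro mult_strict_left_mono) auto
    also have "\<dots> = Min (insert 1 (gap ` S))" using B by (simp add: \<epsilon>_def)
    also have "\<dots> \<le> gap i" using that assms(3) by (intro Min_le) auto
    finally show ?thesis .
  qed
  \<comment> \<open>Adding \<open>R\<close> ranks all of \<open>T\<close> above \<open>S\<close>; as
    the two commute, no letter of \<open>T\<close> can be followed by one of
    \<open>S\<close>.\<close>
  define R where "R = Suc (Max (insert 0 (\<rho> ` S)))"
  have R: "\<rho> i < R" if "i \<in> S" for i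
    using that assms(3) by (auto simp: R_def less_Suc_eq_le intro!: Max_ge)
  define \<psi> where "\<psi> = (\<lambda>i. if i \<in> S then \<phi> i else \<epsilon> * \<phi>' i)"
  define N where "N = (\<lambda>i. if i \<in> S then {j \<in> S. \<rho> i \<le> \<rho> j \<or> M i j \<noteq> 2} \<union> T
     else {j \<in> T. \<rho>' i \<le> \<rho>' j \<or> M i j \<noteq> 2})"
  have sT: "sum \<psi> A = \<epsilon> * sum \<phi>' A" if "A \<subseteq> T" for A
    unfolding sum_distrib_left using that assms(5) by (intro sum.cong) (auto simp: \<psi>_def)
  have sS: "sum \<psi> A = sum \<phi> A" if "A \<subseteq> S" for A
    using that by (intro sum.cong) (auto simp: \<psi>_def)
  show ?thesis
  proof (rule subcriticalI[where \<phi> = \<psi> and N = N and \<rho> = "\<lambda>i. if i \<in> S then \<rho> i else R + \<rho>' i"])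
    fix i assume i: "i \<in> S \<union> T"
    show "\<psi> i > 0" using i S(1) T(1) e by (auto simp: \<psi>_def)
    show "finite (N i) \<and> N i \<subseteq> S \<union> T" using assms(3,4) by (auto simp: N_def)
    show "sum \<psi> (N i) < 4 * \<psi> i"
    proof (cases "i \<in> S")
      case True
      have "sum \<psi> (N i) = sum \<psi> {j \<in> S. \<rho> i \<le> \<rho> j \<or> M i j \<noteq> 2} + sum \<psi> T"
        using True assms(3-5) by (auto simp: N_def intro!: sum.union_disjoint)
      also have "\<dots> = sum \<phi> {j \<in> S. \<rho> i \<le> \<rho> j \<or> M i j \<noteq> 2} + \<epsilon> * B"
        using sT[of T] sS[of "{j \<in> S. \<rho> i \<le> \<rho> j \<or> M i j \<noteq> 2}"] by (auto simp: B_def)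
      finally show ?thesis using eB[OF True] True by (simp add: gap_def \<psi>_def)
    next
      case False
      then have "i \<in> T" using i by auto
      from T(2)[OF this] have "\<epsilon> * sum \<phi>' {j \<in> T. \<rho>' i \<le> \<rho>' j \<or> M i j \<noteq> 2} < \<epsilon> * (4 * \<phi>' i)"
        using e by (rule mult_strict_left_mono)
      then show ?thesis using False sT[of "{j \<in> T. \<rho>' i \<le> \<rho>' j \<or> M i j \<noteq> 2}"] by (auto simp: N_def \<psi>_def)
    qed
  next
    fix i j assume ij: "i \<in> S \<union> T" "j \<in> S \<union> T"
      "(if i \<in> S then \<rho> i else R + \<rho>' i) \<le> (if j \<in> S then \<rho> j else R + \<rho>' j) \<or> M i j \<noteq> 2"
    then show "j \<in> N i" using R[of j] assms(5,6) by (auto simp: N_def split: if_splits)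
  qed
qed

section \<open>Weights for the connected diagrams\<close>

lemma sum_telescope_le:
  fixes S :: "nat \<Rightarrow> real"
  assumes "a \<le> k"
  shows "(\<Sum>j = a..<k. S j - S (Suc j)) = S a - S k"
  using sum_Suc_diff'[OF assms, of "\<lambda>j. - S j"] by simp

text \<open>Writing the tail sums of the weights as \<open>S i = s i / 2 ^ i\<close>, the inequality for a vertex
  of a chain says exactly that \<open>s\<close> is strictly concave; \<open>s i = K - i\<^sup>2\<close> is the simplest choice.\<close>

definition tail :: "real \<Rightarrow> nat \<Rightarrow> real" where
  "tail K i = (K - (real i)\<^sup>2) / 2 ^ i"

lemma tail_Suc_less:
  assumes "K > (real i)\<^sup>2"
  shows "tail K (Suc i) < tail K i"
proof -
  have "(real (Suc i))\<^sup>2 = (real i)\<^sup>2 + 2 * real i + 1" by (simp add: power2_eq_square algebra_simps)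
  then have "(K - (real (Suc i))\<^sup>2) / 2 < K - (real i)\<^sup>2" 
    using assms by (simp add: field_simps)
  then have "(K - (real (Suc i))\<^sup>2) / 2 / 2 ^ i < (K - (real i)\<^sup>2) / 2 ^ i"
    by (rule divide_strict_right_mono) simp
  then show ?thesis by (simp add: tail_def)
qed

text \<open>The second inequality is the row of vertex 0, which has no predecessor, so that its
  followers weigh \<open>tail K 0\<close> in total.\<close>

lemma tail_concave:
  shows "tail K i < 4 * (tail K (Suc i) - tail K (Suc (Suc i)))"
    and "K \<ge> 0 \<Longrightarrow> tail K 0 < 4 * (tail K 0 - tail K (Suc 0))"
  by (auto simp: tail_def field_simps power2_eq_square)

lemma subcritical_path:
  assumes "\<And>i j. j + 2 \<le> i \<Longrightarrow> i < k \<Longrightarrow> L i j = 2"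
  shows "subcritical L {..<k}"
proof -
  \<comment> \<open>With this constant the tail is positive below \<open>k\<close> and vanishes at
    \<open>k\<close>, so telescoping leaves the first term alone.\<close>
  let ?S = "tail ((real k)\<^sup>2)"
  show ?thesis
  proof (rule subcriticalI[where \<rho> = "\<lambda>i. i" and \<phi> = "\<lambda>i. ?S i - ?S (Suc i)" and N = "\<lambda>i. {i - 1..<k}"])
    fix i assume i: "i \<in> {..<k}"
    have "(real i)\<^sup>2 < (real k)\<^sup>2" using i by (intro power_strict_mono) auto
    then show "?S i - ?S (Suc i) > 0" using tail_Suc_less by simp
    have "?S k = 0" by (simp add: tail_def)
    then have "(\<Sum>j = i - 1..<k. ?S j - ?S (Suc j)) = ?S (i - 1)"
      using sum_telescope_le[of "i - 1" k ?S] i by simp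
    also have "\<dots> < 4 * (?S i - ?S (Suc i))" using tail_concave by (cases i) auto
    finally show "(\<Sum>j = i - 1..<k. ?S j - ?S (Suc j)) < 4 * (?S i - ?S (Suc i))" .
  next
    fix i j assume "i \<in> {..<k}" "j \<in> {..<k}" "i \<le> j \<or> L i j \<noteq> 2"
    then show "j \<in> {i - 1..<k}" using assms[of j i] by force
  qed auto
qed

lemma subcritical_D:
  assumes "k = m + 2" "m \<ge> 2"
    and "\<And>i j. j + 2 \<le> i \<Longrightarrow> i \<le> m \<Longrightarrow> L i j = 2" "\<And>j. j \<le> m \<Longrightarrow> j \<noteq> m - 1 \<Longrightarrow> L (Suc m) j = 2"
  shows "subcritical L {..<k}"
proof -
  \<comment> \<open>The factor 10 keeps the ratio of the tails at m - 1 and m below 20/9, which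
    suffices for the bounds 9/4 and 7/3 needed at the two leaves.\<close>
  define K where "K = 10 * (real k)\<^sup>2"
  let ?S = "tail K"
  \<comment> \<open>Up to the branch vertex these are path weights; the last tail is shared by the
    leaves. As consecutive tails have ratio close to 2, the share x of leaf \<open>m\<close> must
    satisfy 4x > 2 and 1 + 3(1 - x) > 2; 7/12 is the midpoint between 1/2 and 2/3.\<close>
  define \<phi> where "\<phi> = (\<lambda>i. if i < m then ?S i - ?S (Suc i) else if i = m then 7/12 * ?S m else 5/12 * ?S m)"
  \<comment> \<open>The leaf \<open>Suc m\<close> commutes with the lower-ranked leaf
    \<open>m\<close>, which therefore cannot follow it.\<close>
  define N where "N = (\<lambda>i. if i = Suc m then {m - 1, Suc m} else {i - 1..<k})"
  have K: "K > 10 * (real i)\<^sup>2" if "i < k" for i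
    using that unfolding K_def by (auto intro!: power_strict_mono)
  have Sm: "?S i > 0" if "i < k" for i
  proof -
    have "K > (real i)\<^sup>2" using K[OF that] zero_le_power2[of "real i"] by linarith
    then show ?thesis by (simp add: tail_def)
  qed
  have S1: "?S (Suc i) < ?S i" if "i < k" for i
    using K[OF that] zero_le_power2[of "real i"] by (intro tail_Suc_less) linarith
  have sumN: "sum \<phi> {a..<k} = ?S a" if "a \<le> m" for a
  proof -
    have "sum \<phi> {a..<k} = sum \<phi> {a..<m} + \<phi> m + \<phi> (Suc m)" using that by (simp add: assms(1))
    also have "sum \<phi> {a..<m} = (\<Sum>j = a..<m. ?S j - ?S (Suc j))" by (intro sum.cong) (auto simp: \<phi>_def)
    also have "\<dots> = ?S a - ?S m" using that by (rule sum_telescope_le)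
    finally show ?thesis by (simp add: \<phi>_def)
  qed
  obtain t where t: "m = Suc t" using assms(2) by (cases m) auto
  have half: "?S m = (K - (real m)\<^sup>2) / 2 / 2 ^ t" "?S t = (K - (real t)\<^sup>2) / 2 ^ t"
    by (simp_all add: tail_def t)
  have Km: "10 * (real m)\<^sup>2 < K" using K[of m] assms(1) by simp
  have aux: "4 * (K - b) < 9 * ((K - a) / 2) \<and> 3 * (K - b) < 7 * ((K - a) / 2)"
    if "10 * a < K" "0 \<le> a" "0 \<le> b" for a b using that by (simp add: field_simps)
  have "9 * ((K - (real m)\<^sup>2) / 2) > 4 * (K - (real t)\<^sup>2)" "7 * ((K - (real m)\<^sup>2) / 2) > 3 * (K - (real t)\<^sup>2)"
    using aux[OF Km] by simp_all
  from this[THEN divide_strict_right_mono, of "2 ^ t"]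
  have r: "9 * ?S m > 4 * ?S t" "7 * ?S m > 3 * ?S t"
    unfolding half by simp_all
  show ?thesis
  proof (rule subcriticalI[where \<rho> = "\<lambda>i. i" and \<phi> = \<phi> and N = N])
    fix i assume i: "i \<in> {..<k}"
    show "\<phi> i > 0" using S1 Sm[of m] i by (auto simp: \<phi>_def assms(1))
    show "finite (N i) \<and> N i \<subseteq> {..<k}" using i by (auto simp: N_def assms(1))
    consider "i < m" | "i = m" | "i = Suc m" using i assms(1) by force
    then show "sum \<phi> (N i) < 4 * \<phi> i"
    proof cases
      case 1
      then have "sum \<phi> (N i) = ?S (i - 1)" using sumN[of "i - 1"] by (simp add: N_def)
      also have "\<dots> < 4 * \<phi> i" using tail_concave 1 by (cases i) (auto simp: \<phi>_def K_def)
      finally show ?thesis .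
    next
      case 2
      then have "sum \<phi> (N i) = ?S t" using sumN[of t] by (simp add: N_def t)
      then show ?thesis using r 2 by (simp add: \<phi>_def)
    next
      case 3
      then have "sum \<phi> (N i) = ?S t - ?S m + 5/12 * ?S m" by (simp add: N_def t \<phi>_def)
      then show ?thesis using r 3 by (simp add: \<phi>_def)
    qed
  next
    fix i j assume "i \<in> {..<k}" "j \<in> {..<k}" "i \<le> j \<or> L i j \<noteq> 2"
    then show "j \<in> N i" using assms(3)[of j i] assms(4)[of j] assms(1) by (force simp: N_def)
  qed
qed

definition weight_check :: "nat \<Rightarrow> (nat \<times> nat \<times> nat) list \<Rightarrow> nat list \<Rightarrow> nat list \<Rightarrow> bool" where
  "weight_check k es rs ws \<longleftrightarrow> list_all (\<lambda>i. ws ! i > 0 \<and>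
     sum_list (map (\<lambda>j. if rs ! i \<le> rs ! j \<or> edge_label es i j \<noteq> 2 then ws ! j else 0) [0..<k]) < 4 * ws ! i) [0..<k]"

lemma subcritical_check:
  assumes "weight_check k es rs ws"
  shows "subcritical (edge_label es) {..<k}"
  unfolding subcritical_def
proof (intro exI[of _ "\<lambda>i. rs ! i"] exI[of _ "\<lambda>i. real (ws ! i)"] ballI conjI)
  fix i assume i: "i \<in> {..<k}"
  have w: "ws ! i > 0"
    "sum_list (map (\<lambda>j. if rs ! i \<le> rs ! j \<or> edge_label es i j \<noteq> 2 then ws ! j else 0) [0..<k]) < 4 * ws ! i"
    using assms i by (auto simp: weight_check_def list_all_iff)
  then show "real (ws ! i) > 0" by simp
  have "sum_list (map (\<lambda>j. if rs ! i \<le> rs ! j \<or> edge_label es i j \<noteq> 2 then ws ! j else 0) [0..<k]) =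
      (\<Sum>j<k. if rs ! i \<le> rs ! j \<or> edge_label es i j \<noteq> 2 then ws ! j else 0)"
    by (simp add: interv_sum_list_conv_sum_set_nat atLeast0LessThan)
  also have "\<dots> = (\<Sum>j | j \<in> {..<k} \<and> (rs ! i \<le> rs ! j \<or> edge_label es i j \<noteq> 2). ws ! j)"
    by (rule sum.inter_filter[symmetric]) simp
  finally have "(\<Sum>j | j \<in> {..<k} \<and> (rs ! i \<le> rs ! j \<or> edge_label es i j \<noteq> 2). ws ! j) < 4 * ws ! i"
    using w by simp
  then have "real (\<Sum>j | j \<in> {..<k} \<and> (rs ! i \<le> rs ! j \<or> edge_label es i j \<noteq> 2). ws ! j) < real (4 * ws ! i)"
    by (simp only: of_nat_less_iff)
  then show "(\<Sum>j | j \<in> {..<k} \<and> (rs ! i \<le> rs ! j \<or> edge_label es i j \<noteq> 2). real (ws ! j)) < 4 * real (ws ! i)"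
    by simp
qed

text \<open>The weights are rounded Perron eigenvectors. Ranking the leaf between the vertices 1 and 2 makes
  the rank a transitive orientation of the commutation graph, so that counting normal words by pairs of
  adjacent letters loses nothing; the margin at \<open>E\<^sub>8\<close> (3.802) depends on this.\<close>

lemma weight_check_E6: "weight_check 6 [(2,5,3),(0,1,3),(1,2,3),(2,3,3),(3,4,3)]
    [0,2,4,6,8,3] [13,13,9,4,2,6]"
  by code_simp
lemma weight_check_E7: "weight_check 7 [(2,6,3),(0,1,3),(1,2,3),(2,3,3),(3,4,3),(4,5,3)]
    [0,2,4,6,8,10,3] [32,32,24,11,5,2,15]"
  by code_simp
lemma weight_check_E8: "weight_check 8 [(2,7,3),(0,1,3),(1,2,3),(2,3,3),(3,4,3),(4,5,3),(5,6,3)]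
    [0,2,4,6,8,10,12,3] [75,75,55,26,12,5,2,36]"
  by code_simp

lemma subcritical_std:
  assumes "std_diag k es"
  shows "subcritical (edge_label es) {..<k}"
  using assms unfolding std_diag_def
proof (elim disjE conjE exE, goal_cases)
  case 1
  show ?case by (rule subcritical_path) (auto simp: 1 diag_A_def edge_label_chain)
next
  case 2
  show ?case by (rule subcritical_path) (auto simp: 2 diag_B_def edge_label_chain)
next
  case 3
  show ?case
    by (rule subcritical_D[of _ "k - 2"]) (use 3 in \<open>auto simp: diag_D_def edge_label_chain split: if_splits\<close>)
next
  case 4
  consider "k = 6" | "k = 7" | "k = 8" using 4(1) by blast
  then show ?case
    by cases (simp_all only: 4(2) diag_E_eq subcritical_check[OF weight_check_E6]
        subcritical_check[OF weight_check_E7] subcritical_check[OF weight_check_E8])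
next
  case 5
  show ?case by (rule subcritical_path) (auto simp: 5 diag_F4_def)
next
  case 6
  show ?case by (rule subcritical_path) (auto simp: 6 diag_I2_def)
next
  case 7
  show ?case by (rule subcritical_path) (auto simp: 7 diag_H_def edge_label_chain)
next
  case 8
  show ?case by (rule subcritical_path) (auto simp: 8 diag_I2_def)
qed

lemma spherical_subcritical:
  assumes "spherical n M"
  shows "subcritical M {..<n}"
proof -
  obtain P where cm: "components n M P" using spherical_components[OF assms] by blast
  note P = componentsD(1,2)[OF cm] and disj = componentsD(3)[OF cm]
    and cross = componentsD(4)[OF cm] and std = componentsD(5)[OF cm]
  have one: "subcritical M C" if C: "C \<in> P" for C
  proof -
    obtain f es where f: "bij_betw f C {..<card C}" "std_diag (card C) es"
      "\<forall>i\<in>C. \<forall>j\<in>C. i \<noteq> j \<longrightarrow> M i j = edge_label es (f i) (f j)" using std[OF C] by blast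
    show ?thesis using subcritical_relabel[OF subcritical_std[OF f(2)] f(1)] f(3) by blast
  qed
  have fin: "finite C" if "C \<in> P" for C
    using P(1) that by (metis Union_upper finite_lessThan finite_subset)
  have "subcritical M (\<Union>Q)" if "Q \<subseteq> P" for Q
    using finite_subset[OF that P(2)] that
  proof (induction rule: finite_induct)
    case empty
    show ?case by (simp add: subcritical_def)
  next
    case (insert C Q)
    have "subcritical M (C \<union> \<Union>Q)"
    proof (rule subcritical_Un)
      show "C \<inter> \<Union>Q = {}" using disj insert by blast
      show "M j i = 2" if "i \<in> C" "j \<in> \<Union>Q" for i j using cross insert that by blast
    qed (use insert one fin in auto)
    then show ?case by simp
  qed
  from this[OF order.refl] show ?thesis using P(1) by simp
qed

section \<open>Normal words and their number\<close>

definition normal_words :: "nat \<Rightarrow> (nat \<Rightarrow> nat \<Rightarrow> nat) \<Rightarrow> (nat \<Rightarrow> nat) \<Rightarrow> nat \<Rightarrow> nat list set" where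
  "normal_words n M \<rho> k =
     {w. length w = k \<and> pos_word n w \<and> successively (\<lambda>i j. \<rho> i \<le> \<rho> j \<or> M i j \<noteq> 2) w}"

lemma finite_normal_words: "finite (normal_words n M \<rho> k)"
  by (rule finite_subset[OF _ finite_lists_length_eq[of "{..<n}" k]])
    (auto simp: normal_words_def pos_word_def)

lemma not_successively_split:
  "\<not> successively R w \<Longrightarrow> \<exists>u i j v. w = u @ i # j # v \<and> \<not> R i j"
proof (induction w rule: induct_list012)
  case (3 x y zs)
  show ?case
  proof (cases "R x y")
    case True
    then obtain u i j v where "y # zs = u @ i # j # v" "\<not> R i j" using 3 by auto
    then have "x # y # zs = (x # u) @ i # j # v \<and> \<not> R i j" by simp
    then show ?thesis by blast
  next
    case False
    then have "x # y # zs = [] @ x # y # zs \<and> \<not> R x y" by simp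
    then show ?thesis by blast
  qed
qed auto

text \<open>Swapping two adjacent letters into increasing rank lowers the moment.\<close>

fun moment :: "(nat \<Rightarrow> nat) \<Rightarrow> nat list \<Rightarrow> nat" where
  "moment \<rho> [] = 0"
| "moment \<rho> (x # w) = \<rho> x * Suc (length w) + moment \<rho> w"

lemma moment_append_less:
  "moment \<rho> a < moment \<rho> b \<Longrightarrow> length a = length b \<Longrightarrow> moment \<rho> (u @ a) < moment \<rho> (u @ b)"
  by (induction u) auto

text \<open>A word of least moment in its congruence class admits no further swap of commuting
  letters into increasing rank.\<close>

lemma ex_normal_word:
  assumes "pos_word n w"
  shows "\<exists>w' \<in> normal_words n M \<rho> (length w). peq n M w w'"
proof -
  obtain w' where w': "peq n M w w'" and min: "\<And>v. peq n M w v \<Longrightarrow> moment \<rho> w' \<le> moment \<rho> v"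
    using ex_has_least_nat[of "peq n M w" w "moment \<rho>"] by blast
  have pos: "pos_word n w'" using peq_pos_word[OF w'] assms by simp
  have "successively (\<lambda>i j. \<rho> i \<le> \<rho> j \<or> M i j \<noteq> 2) w'"
  proof (rule ccontr)
    assume "\<not> ?thesis"
    then obtain u i j v where s: "w' = u @ i # j # v" and ij: "\<not> (\<rho> i \<le> \<rho> j \<or> M i j \<noteq> 2)"
      using not_successively_split by blast
    have "i < n" "j < n" using pos by (auto simp: s pos_word_def)
    moreover have "i \<noteq> j" using ij by auto
    ultimately have "peq n M w' (u @ j # i # v)"
      using peq.prel[of i n j M u v] ij by (simp add: s numeral_2_eq_2)
    then have "moment \<rho> w' \<le> moment \<rho> (u @ j # i # v)" using min peq.ptrans[OF w'] by blast
    moreover have "moment \<rho> (u @ j # i # v) < moment \<rho> w'"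
      unfolding s by (rule moment_append_less) (use ij in \<open>auto simp: algebra_simps\<close>)
    ultimately show False by simp
  qed
  then show ?thesis using w' pos peq_length[OF w'] by (auto simp: normal_words_def)
qed

text \<open>The weights dominate the counts: by induction on the length, the words starting with
  \<open>i\<close> are at most a constant times \<open>\<phi> i * \<theta> ^ m\<close>. As there are
  finitely many rows, the largest ratio \<open>\<theta>\<close> of row sum to weight is still below
  4.\<close>

lemma card_normal_words_le:
  assumes "subcritical M {..<n}"
  shows "\<exists>\<rho> C \<theta>. 0 \<le> C \<and> 1 \<le> \<theta> \<and> \<theta> < 4 \<and> (\<forall>k. real (card (normal_words n M \<rho> k)) \<le> C * \<theta> ^ k)"
proof -
  obtain \<rho> :: "nat \<Rightarrow> nat" and \<phi> :: "nat \<Rightarrow> real" where \<phi>: "\<And>i. i < n \<Longrightarrow> \<phi> i > 0"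
    and sub: "\<And>i. i < n \<Longrightarrow> sum \<phi> {j \<in> {..<n}. \<rho> i \<le> \<rho> j \<or> M i j \<noteq> 2} < 4 * \<phi> i"
    using assms by (auto simp: subcritical_def)
  define N where "N = (\<lambda>i. {j \<in> {..<n}. \<rho> i \<le> \<rho> j \<or> M i j \<noteq> 2})"
  \<comment> \<open>The inserted 1 keeps this maximum and the minimum below defined for
    \<open>n = 0\<close> and makes \<open>\<theta>\<close> at least 1.\<close>
  define \<theta> where "\<theta> = Max (insert 1 ((\<lambda>i. sum \<phi> (N i) / \<phi> i) ` {..<n}))"
  define c where "c = Min (insert 1 (\<phi> ` {..<n}))"
  have l1: "1 \<le> \<theta>" unfolding \<theta>_def by (intro Max_ge) auto
  have l4: "\<theta> < 4" using sub \<phi> by (auto simp: \<theta>_def N_def divide_less_eq)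
  have l: "sum \<phi> (N i) \<le> \<theta> * \<phi> i" if "i < n" for i
  proof -
    have "sum \<phi> (N i) / \<phi> i \<le> \<theta>" unfolding \<theta>_def using that by (intro Max_ge) auto
    then show ?thesis using \<phi>[OF that] by (simp add: divide_le_eq)
  qed
  have c: "c > 0" using \<phi> by (auto simp: c_def)
  have cle: "c \<le> \<phi> i" if "i < n" for i unfolding c_def using that by (intro Min_le) auto
  define A where "A = (\<lambda>m i. {w \<in> normal_words n M \<rho> (Suc m). hd w = i})"
  have finA: "finite (A m i)" for m i using finite_normal_words by (simp add: A_def)
  have A: "real (card (A m i)) \<le> \<phi> i / c * \<theta> ^ m" if "i < n" for m i
    using that
  proof (induction m arbitrary: i)
    case 0
    have "A 0 i \<subseteq> {[i]}" by (auto simp: A_def normal_words_def length_Suc_conv)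
    then have "card (A 0 i) \<le> 1" using card_mono[of "{[i]}" "A 0 i"] by simp
    then have "real (card (A 0 i)) \<le> 1" by simp
    also have "1 \<le> \<phi> i / c" using cle[OF 0] c by simp
    finally show ?case by simp
  next
    case (Suc m)
    have "A (Suc m) i \<subseteq> (\<Union>j \<in> N i. (#) i ` A m j)"
    proof
      fix w assume w: "w \<in> A (Suc m) i"
      then obtain j v where "w = i # j # v" by (auto simp: A_def normal_words_def length_Suc_conv)
      then show "w \<in> (\<Union>j \<in> N i. (#) i ` A m j)"
        using w by (auto simp: A_def N_def normal_words_def pos_word_def)
    qed
    then have "card (A (Suc m) i) \<le> card (\<Union>j \<in> N i. (#) i ` A m j)"
      by (intro card_mono) (auto simp: N_def finA)
    also have "\<dots> \<le> (\<Sum>j \<in> N i. card ((#) i ` A m j))" by (rule card_UN_le) (simp add: N_def)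
    also have "\<dots> = (\<Sum>j \<in> N i. card (A m j))" by (intro sum.cong card_image) auto
    finally have "real (card (A (Suc m) i)) \<le> (\<Sum>j \<in> N i. real (card (A m j)))"
      by (metis of_nat_le_iff of_nat_sum)
    also have "\<dots> \<le> (\<Sum>j \<in> N i. \<phi> j / c * \<theta> ^ m)" by (intro sum_mono Suc.IH) (simp add: N_def)
    also have "\<dots> = sum \<phi> (N i) * (\<theta> ^ m / c)" by (simp add: sum_distrib_right sum_divide_distrib)
    also have "\<dots> \<le> \<theta> * \<phi> i * (\<theta> ^ m / c)"
      using l[OF Suc.prems] l1 c by (intro mult_right_mono) auto
    finally show ?case by (simp add: mult_ac)
  qed
  define C where "C = 1 + sum \<phi> {..<n} / c"
  have C1: "sum \<phi> {..<n} / c \<ge> 0"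
    using \<phi> c by (intro divide_nonneg_pos sum_nonneg) (auto intro: less_imp_le)
  have "real (card (normal_words n M \<rho> k)) \<le> C * \<theta> ^ k" for k
  proof (cases k)
    case 0
    have "normal_words n M \<rho> 0 \<subseteq> {[]}" by (auto simp: normal_words_def)
    then have "card (normal_words n M \<rho> 0) \<le> 1"
      using card_mono[of "{[]}" "normal_words n M \<rho> 0"] by simp
    then show ?thesis using C1 0 by (simp add: C_def)
  next
    case (Suc m)
    have "normal_words n M \<rho> k \<subseteq> (\<Union>i<n. A m i)"
    proof
      fix w assume w: "w \<in> normal_words n M \<rho> k"
      then obtain i v where "w = i # v" by (auto simp: Suc normal_words_def length_Suc_conv)
      then show "w \<in> (\<Union>i<n. A m i)" using w by (auto simp: A_def Suc normal_words_def pos_word_def)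
    qed
    then have "card (normal_words n M \<rho> k) \<le> card (\<Union>i<n. A m i)"
      by (intro card_mono) (auto simp: finA)
    also have "\<dots> \<le> (\<Sum>i<n. card (A m i))" by (rule card_UN_le) simp
    finally have "real (card (normal_words n M \<rho> k)) \<le> (\<Sum>i<n. real (card (A m i)))"
      by (metis of_nat_le_iff of_nat_sum)
    also have "\<dots> \<le> (\<Sum>i<n. \<phi> i / c * \<theta> ^ m)" by (intro sum_mono A) simp
    also have "\<dots> = sum \<phi> {..<n} / c * \<theta> ^ m" by (simp add: sum_distrib_right sum_divide_distrib)
    also have "\<dots> \<le> C * \<theta> ^ k"
      using C1 l1 by (intro mult_mono power_increasing) (auto simp: C_def Suc)
    finally show ?thesis .
  qed
  moreover have "0 \<le> C" using C1 by (simp add: C_def)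
  ultimately show ?thesis using l1 l4 by blast
qed

section \<open>From the monoid to the group\<close>

abbreviation pos :: "nat list \<Rightarrow> (nat \<times> bool) list" where
  "pos w \<equiv> map (\<lambda>a. (a, True)) w"

lemma geq_append:
  assumes "geq n M u v"
  shows "geq n M (x @ u @ y) (x @ v @ y)"
  using assms
proof induction
  case (gcancel i u b v)
  then show ?case using geq.gcancel[of i n M "x @ u" b "v @ y"] by simp
next
  case (grel i j u v)
  then show ?case using geq.grel[of i n j M "x @ u" "v @ y"] by simp
qed (blast intro: geq.grefl geq.gsym geq.gtrans)+

lemma geq_appL: "geq n M u v \<Longrightarrow> geq n M (x @ u) (x @ v)"
  using geq_append[of n M u v x "[]"] by simp

lemma geq_appR: "geq n M u v \<Longrightarrow> geq n M (u @ y) (v @ y)"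
  using geq_append[of n M u v "[]" y] by simp

lemma peq_imp_geq:
  assumes "peq n M u v"
  shows "geq n M (pos u) (pos v)"
  using assms
proof induction
  case (prel i j u v)
  then show ?case using geq.grel[of i n j M "pos u" "pos v"] by simp
qed (blast intro: geq.grefl geq.gsym geq.gtrans)+

lemma gclass_eq: "geq n M u v \<Longrightarrow> gclass n M u = gclass n M v"
  unfolding gclass_def by (blast intro: geq.gsym geq.gtrans)

text \<open>The sign \<open>b\<close> stays free because \<nabla> has to be both a left and a right
  inverse of \<Delta>.\<close>

lemma geq_inverse:
  assumes "set w \<subseteq> {..<n}"
  shows "geq n M (map (\<lambda>a. (a, b)) w @ rev (map (\<lambda>a. (a, \<not> b)) w)) []"
  using assms
proof (induction w)
  case (Cons a w)
  have "geq n M (map (\<lambda>a. (a, b)) (a # w) @ rev (map (\<lambda>a. (a, \<not> b)) (a # w))) ([(a, b)] @ [] @ [(a, \<not> b)])"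
    using geq_append[OF Cons.IH, of "[(a, b)]" "[(a, \<not> b)]"] Cons.prems by simp
  also have "geq n M ([(a, b)] @ [] @ [(a, \<not> b)]) []"
    using geq.gcancel[of a n M "[]" b "[]"] Cons.prems by simp
  finally (geq.gtrans) show ?case .
qed (simp add: geq.grefl)

lemma geq_nabla:
  assumes "pos_word n (garside n M)"
  shows "geq n M (pos (garside n M) @ nabla_word n M) []"
    and "geq n M (nabla_word n M @ pos (garside n M)) []"
proof -
  show "geq n M (pos (garside n M) @ nabla_word n M) []"
    using geq_inverse[of "garside n M" n M True] assms by (simp add: nabla_word_def pos_word_def)
  show "geq n M (nabla_word n M @ pos (garside n M)) []"
    using geq_inverse[of "rev (garside n M)" n M False] assms
    by (simp add: nabla_word_def pos_word_def rev_map)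
qed

text \<open>Multiply \<open>\<Delta> j = j' \<Delta>\<close> by \<nabla> on both sides and
  cancel.\<close>

lemma letter_nabla:
  assumes "spherical n M" "j < n"
  shows "\<exists>j'<n. geq n M ((j, True) # nabla_word n M) (nabla_word n M @ [(j', True)])"
proof -
  define D where "D = pos (garside n M)"
  define N where "N = nabla_word n M"
  obtain j' where j': "j' < n" "peq n M (garside n M @ [j]) (j' # garside n M)"
    using spherical_garside(1)[OF assms] by blast
  have e: "geq n M (D @ [(j, True)]) ((j', True) # D)"
    using peq_imp_geq[OF j'(2)] by (simp add: D_def)
  have DN: "geq n M (D @ N) []" "geq n M (N @ D) []"
    using geq_nabla[OF spherical_garside(2)[OF assms(1)]] by (simp_all add: D_def N_def)
  have 1: "geq n M ((N @ D) @ (j, True) # N) ((j, True) # N)" using geq_appR[OF DN(2)] by simp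
  have 2: "geq n M (N @ (D @ [(j, True)]) @ N) (N @ ((j', True) # D) @ N)" by (rule geq_append[OF e])
  have 3: "geq n M ((N @ [(j', True)]) @ D @ N) (N @ [(j', True)])"
    using geq_appL[OF DN(1), of "N @ [(j', True)]"] by simp
  have "geq n M ((j, True) # N) (N @ [(j', True)])"
    using geq.gtrans[OF geq.gsym[OF 1] geq.gtrans[OF _ 3]] 2 by simp
  then show ?thesis using j'(1) unfolding N_def by blast
qed

lemma letter_nablas:
  assumes "spherical n M" "j < n"
  shows "\<exists>j'<n. geq n M ((j, True) # concat (replicate r (nabla_word n M)))
     (concat (replicate r (nabla_word n M)) @ [(j', True)])"
  using assms(2)
proof (induction r arbitrary: j)
  case 0
  then show ?case by (auto intro: geq.grefl)
next
  case (Suc r)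
  let ?N = "nabla_word n M" and ?R = "concat (replicate r (nabla_word n M))"
  obtain i where i: "i < n" "geq n M ((j, True) # ?N) (?N @ [(i, True)])"
    using letter_nabla[OF assms(1) Suc.prems] by blast
  obtain j' where j': "j' < n" "geq n M ((i, True) # ?R) (?R @ [(j', True)])"
    using Suc.IH[OF i(1)] by blast
  have "geq n M (((j, True) # ?N) @ ?R) ((?N @ [(i, True)]) @ ?R)" by (rule geq_appR[OF i(2)])
  moreover have "geq n M (?N @ (i, True) # ?R) (?N @ ?R @ [(j', True)])" by (rule geq_appL[OF j'(2)])
  ultimately have "geq n M ((j, True) # ?N @ ?R) (?N @ ?R @ [(j', True)])"
    using geq.gtrans by fastforce
  then show ?case using j'(1) by auto
qed

text \<open>A generator that moves right over a power of \<nabla> turns into a single generator, so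
  the number of letters is preserved; \<open>r\<close> counts the occurrences of \<nabla>.\<close>

lemma eval_word_normal:
  assumes "spherical n M" "valid_mword n w"
  shows "\<exists>r p. r + length p = length w \<and> pos_word n p \<and>
     geq n M (eval_word n M w) (concat (replicate r (nabla_word n M)) @ pos p)"
  using assms(2)
proof (induction w)
  case Nil
  show ?case by (rule exI[of _ 0], rule exI[of _ "[]"]) (simp add: eval_word_def pos_word_def geq.grefl)
next
  case (Cons a w)
  let ?N = "nabla_word n M"
  obtain r p where rp: "r + length p = length w" "pos_word n p"
    "geq n M (eval_word n M w) (concat (replicate r ?N) @ pos p)"
    using Cons by (auto simp: valid_mword_def)
  show ?case
  proof (cases a)
    case None
    have "geq n M (eval_word n M (a # w)) (concat (replicate (Suc r) ?N) @ pos p)"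
      using geq_appL[OF rp(3), of ?N] by (simp add: None eval_word_def)
    then show ?thesis using rp by (intro exI[of _ "Suc r"] exI[of _ p]) simp
  next
    case (Some i)
    then have "i < n" using Cons.prems by (auto simp: valid_mword_def)
    then obtain j where j: "j < n"
      "geq n M ((i, True) # concat (replicate r ?N)) (concat (replicate r ?N) @ [(j, True)])"
      using letter_nablas[OF assms(1)] by blast
    have "geq n M (eval_word n M (a # w)) ((i, True) # concat (replicate r ?N) @ pos p)"
      using geq_appL[OF rp(3), of "[(i, True)]"] by (simp add: Some eval_word_def)
    moreover have "geq n M ((i, True) # concat (replicate r ?N) @ pos p) (concat (replicate r ?N) @ pos (j # p))"
      using geq_appR[OF j(2), of "pos p"] by simp
    ultimately have "geq n M (eval_word n M (a # w)) (concat (replicate r ?N) @ pos (j # p))"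
      by (rule geq.gtrans)
    then show ?thesis using rp j(1) by (intro exI[of _ r] exI[of _ "j # p"]) (simp add: pos_word_def)
  qed
qed

text \<open>Every class on the sphere comes from an exponent \<open>r\<close> and a normal word of
  length \<open>k - r\<close>. Shorter elements and repeated representations only enlarge the right
  side.\<close>

lemma sphere_count_le:
  assumes "spherical n M"
  shows "sphere_count n M k \<le> (\<Sum>r\<le>k. card (normal_words n M \<rho> (k - r)))"
proof -
  define F where "F = (\<lambda>(r, p). gclass n M (concat (replicate r (nabla_word n M)) @ pos p))"
  define S where "S = Sigma {..k} (\<lambda>r. normal_words n M \<rho> (k - r))"
  have fin: "finite S" unfolding S_def using finite_normal_words by auto
  have "gclass n M (eval_word n M w) \<in> F ` S" if w: "valid_mword n w" "length w = k" for w
  proof -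
    obtain r p where rp: "r + length p = length w" "pos_word n p"
      "geq n M (eval_word n M w) (concat (replicate r (nabla_word n M)) @ pos p)"
      using eval_word_normal[OF assms w(1)] by blast
    obtain q where q: "q \<in> normal_words n M \<rho> (length p)" "peq n M p q" using ex_normal_word[OF rp(2)] by blast
    have "geq n M (eval_word n M w) (concat (replicate r (nabla_word n M)) @ pos q)"
      using geq.gtrans[OF rp(3) geq_appL[OF peq_imp_geq[OF q(2)]]] .
    then have "gclass n M (eval_word n M w) = F (r, q)" by (simp add: F_def gclass_eq)
    moreover have "length p = k - r" "r \<le> k" using rp(1) w(2) by auto
    then have "(r, q) \<in> S" using q(1) by (auto simp: S_def)
    ultimately show ?thesis by blast
  qed
  then have "sphere_count n M k \<le> card (F ` S)"
    unfolding sphere_count_def using fin by (intro card_mono) auto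
  also have "\<dots> \<le> card S" by (rule card_image_le[OF fin])
  also have "\<dots> = (\<Sum>r\<le>k. card (normal_words n M \<rho> (k - r)))"
    unfolding S_def using finite_normal_words by (intro card_SigmaI) auto
  finally show ?thesis .
qed

section \<open>The growth rate\<close>

lemma limsup_root_less:
  fixes f :: "nat \<Rightarrow> nat" and C \<theta> b :: real
  assumes "0 \<le> C" "0 < \<theta>" "\<theta> < b" "\<And>k. real (f k) \<le> C * (real k + 1) * \<theta> ^ k"
  shows "limsup (\<lambda>k. ereal (root k (real (f k)))) < ereal b"
proof -
  \<comment> \<open>The midpoint leaves room for the linear factor: multiplied by
    \<open>(\<theta> / \<mu>) ^ k\<close> it tends to 0.\<close>
  define \<mu> where "\<mu> = (\<theta> + b) / 2"
  have \<mu>: "\<theta> < \<mu>" "\<mu> < b" "0 < \<mu>" using assms by (auto simp: \<mu>_def)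
  define q where "q = \<theta> / \<mu>"
  have q: "norm q < 1" using assms \<mu> by (simp add: q_def)
  have "(\<lambda>k. C * (real k * q ^ k + q ^ k)) \<longlonglongrightarrow> C * (0 + 0)"
    using powser_times_n_limit_0[OF q] LIMSEQ_power_zero[OF q] q by (intro tendsto_intros) auto
  then have "\<forall>\<^sub>F k in sequentially. C * (real k * q ^ k + q ^ k) < 1"
    by (intro order_tendstoD) auto
  then have "\<forall>\<^sub>F k in sequentially. ereal (root k (real (f k))) \<le> ereal \<mu>"
    using eventually_gt_at_top[of 0]
  proof eventually_elim
    case (elim k)
    have "\<theta> ^ k = q ^ k * \<mu> ^ k" using \<mu> by (simp add: q_def flip: power_mult_distrib)
    then have "real (f k) \<le> C * (real k * q ^ k + q ^ k) * \<mu> ^ k"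
      using assms(4)[of k] by (simp add: algebra_simps)
    also have "\<dots> \<le> 1 * \<mu> ^ k" using elim(1) \<mu> by (intro mult_right_mono) auto
    finally have "root k (real (f k)) \<le> root k (\<mu> ^ k)" using elim(2) by simp
    also have "\<dots> = \<mu>" using elim(2) \<mu> by (simp add: real_root_power_cancel)
    finally show ?case by simp
  qed
  then have "limsup (\<lambda>k. ereal (root k (real (f k)))) \<le> ereal \<mu>" by (rule Limsup_bounded)
  also have "\<dots> < ereal b" using \<mu> by simp
  finally show ?thesis .
qed

theorem theorem2:
  fixes n :: nat and M :: "nat \<Rightarrow> nat \<Rightarrow> nat"
  assumes "spherical n M"
  shows "limsup (\<lambda>k. ereal (root k (real (sphere_count n M k)))) < 4"
proof -
  obtain \<rho> C \<theta> where C: "0 \<le> C" "1 \<le> \<theta>" "\<theta> < 4"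
    and le: "\<And>k. real (card (normal_words n M \<rho> k)) \<le> C * \<theta> ^ k"
    using card_normal_words_le[OF spherical_subcritical[OF assms]] by blast
  have "real (sphere_count n M k) \<le> C * (real k + 1) * \<theta> ^ k" for k
  proof -
    have "real (sphere_count n M k) \<le> (\<Sum>r\<le>k. real (card (normal_words n M \<rho> (k - r))))"
      using sphere_count_le[OF assms, of k \<rho>] by (metis of_nat_le_iff of_nat_sum)
    \<comment> \<open>Since \<open>\<theta>\<close> is at least 1, each of the \<open>k + 1\<close>
      terms is at most the one with the highest power; this yields the linear factor.\<close>
    also have "\<dots> \<le> (\<Sum>r\<le>k. C * \<theta> ^ k)"
    proof (rule sum_mono)
      fix r
      have "C * \<theta> ^ (k - r) \<le> C * \<theta> ^ k" using C by (intro mult_left_mono power_increasing) auto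
      then show "real (card (normal_words n M \<rho> (k - r))) \<le> C * \<theta> ^ k" using le order.trans by blast
    qed
    finally show ?thesis by (simp add: algebra_simps)
  qed
  then show ?thesis using limsup_root_less[of C \<theta> 4 "sphere_count n M"] C by simp
qed

end
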